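(* Let $\mathcal{C}$ be a Markov category with conditionals and let $p$ be a hidden Markov model in $\mathcal{C}$ with transition kernels $f_t\colon X_{t-1}\to X_t$ and observation kernels $g_t\colon X_t\to Y_t$, $t=0,\dots,n$ (with $X_{-1}=I$). Let $y_0\colon I\to Y_0,\dots,y_n\colon I\to Y_n$ be deterministic morphisms. Then the instantiated Bayes filter can be recursively computed through conditionals as $$\mathrm{IBF}_t(\mathbf{y}_{[t]})=\Big((\mathrm{id}_{X_t}\otimes g_t)\circ\mathrm{copy}_{X_t}\circ f_t\circ\mathrm{IBF}_{t-1}(\mathbf{y}_{[t-1]})\Big)_{|Y_t}\circ y_t$$ for all $t=0,\dots,n$, where $\mathrm{IBF}_{-1}:=\mathrm{id}_I$. Here $(\,\cdot\,)_{|Y_t}\colon Y_t\to X_t$ denotes the conditional with respect to $Y_t$ of the state $I\to X_t\otimes Y_t$ in parentheses.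
   Context: A Markov category is a symmetric monoidal category whose monoidal unit $I$ is terminal, in which every object $X$ carries a distinguished commutative comonoid structure $\mathrm{copy}_X\colon X\to X\otimes X$, $\mathrm{del}_X\colon X\to I$, compatible with $\otimes$. Coherence isomorphisms and symmetries are suppressed. A state is a morphism out of $I$. A morphism $f\colon A\to X$ is deterministic if $\mathrm{copy}_X\circ f=(f\otimes f)\circ\mathrm{copy}_A$. Conditionals: a conditional of $f\colon A\to X\otimes Y$ with respect to $Y$ is a morphism $f_{|Y}\colon A\otimes Y\to X$ such that $f$ equals the composite: copy $A$; apply to one copy the marginal $f_Y:=(\mathrm{del}_X\otimes\mathrm{id}_Y)\circ f$; copy the resulting $Y$; output one copy of $Y$ and apply $f_{|Y}$ to the other copy of $A$ and the other copy of $Y$ to produce $X$. $\mathcal{C}$ has conditionals if these always exist. Conditionals are unique only up to almost sure equality, and one speaks of "the" conditional in this sense. Notation: $[t]=\{0,\dots,t\}$; $Y_{[t]}=Y_0\otimes\cdots\otimes Y_t$; $\mathbf{y}_{[t]}$ abbreviates the sequence $y_0,\dots,y_t$. Hidden Markov model: given $f_t\colon X_{t-1}\to X_t$ and $g_t\colon X_t\to Y_t$ ($t=0,\dots,n$, $X_{-1}:=I$), it is the state $p\colon I\to\bigotimes_{t\in[n]}(X_t\otimes Y_t)$, $p=\big(\bigotimes_{t=0}^n((\mathrm{id}_{X_t}\otimes g_t)\circ\mathrm{copy}_{X_t})\big)\circ m_n$, where $m_0=f_0$ and $m_t=\big(\mathrm{id}_{X_0\otimes\cdots\otimes X_{t-2}}\otimes((\mathrm{id}_{X_{t-1}}\otimes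 f_t)\circ\mathrm{copy}_{X_{t-1}})\big)\circ m_{t-1}$. Bayes filter: $\mathrm{BF}_t\colon Y_{[t]}\to X_t$ is the conditional, with respect to $Y_{[t]}$, of the marginal of $p$ on $Y_{[t]}\otimes X_t$; it is unique only up to almost sure equality with respect to the marginal of $p$ on $Y_{[t]}$. Instantiated Bayes filter: $\mathrm{IBF}_t(\mathbf{y}_{[t]}):=\mathrm{BF}_t\circ(y_0\otimes\cdots\otimes y_t)\colon I\to X_t$. Because of the non-uniqueness of $\mathrm{BF}_t$ it is not well-defined in general; each step of the recursion involves a choice of conditional, and making such choices throughout the recursion results in one version of the instantiated Bayes filter. *)

theory Defs
  imports Main
begin

text \<open>
  Markov categories are not assumed to be strict: the associators \<open>\<alpha>\<close>, the unitors \<open>\<ell>\<close>, \<open>\<rho>\<close> and the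
  symmetries \<open>\<sigma>\<close>, which are suppressed in informal string-diagrammatic notation, are written out
  everywhere. Composition \<open>g \<cdot> f\<close> is a total function on the type of arrows, but it is only
  meaningful when the domain of \<open>g\<close> is the codomain of \<open>f\<close>; likewise all structure arrows are only
  meaningful at members of \<open>Obj\<close>.
\<close>

record ('o, 'm) markov_structure =
  Obj :: "'o set"
  Arr :: "'m set"
  Dom :: "'m \<Rightarrow> 'o"
  Cod :: "'m \<Rightarrow> 'o"
  Id :: "'o \<Rightarrow> 'm" ("\<iota>\<index>")
  Comp :: "'m \<Rightarrow> 'm \<Rightarrow> 'm" (infixr "\<cdot>\<index>" 65)
  Unit :: 'o ("\<one>\<index>")
  Tensor_obj :: "'o \<Rightarrow> 'o \<Rightarrow> 'o" (infixr "\<otimes>\<index>" 70)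
  Tensor_arr :: "'m \<Rightarrow> 'm \<Rightarrow> 'm" (infixr "\<boxtimes>\<index>" 70)
  Assoc :: "'o \<Rightarrow> 'o \<Rightarrow> 'o \<Rightarrow> 'm" ("\<alpha>\<index>")
  Lunit :: "'o \<Rightarrow> 'm" ("\<ell>\<index>")
  Runit :: "'o \<Rightarrow> 'm" ("\<rho>\<index>")
  Sym :: "'o \<Rightarrow> 'o \<Rightarrow> 'm" ("\<sigma>\<index>")
  Copy :: "'o \<Rightarrow> 'm" ("copy\<index>")
  Del :: "'o \<Rightarrow> 'm" ("del\<index>")

definition hom :: "('o, 'm, 'z) markov_structure_scheme \<Rightarrow> 'o \<Rightarrow> 'o \<Rightarrow> 'm set" where
  "hom C A B = {f \<in> Arr C. Dom C f = A \<and> Cod C f = B}"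

definition is_inverse :: "('o, 'm, 'z) markov_structure_scheme \<Rightarrow> 'm \<Rightarrow> 'm \<Rightarrow> bool" where
  "is_inverse C f g \<longleftrightarrow> f \<in> Arr C \<and> g \<in> hom C (Cod C f) (Dom C f) \<and>
     g \<cdot> f = \<iota> (Dom C f) \<and> f \<cdot> g = \<iota> (Cod C f)" for C (structure)

definition iso :: "('o, 'm, 'z) markov_structure_scheme \<Rightarrow> 'm \<Rightarrow> bool" where
  "iso C f \<longleftrightarrow> (\<exists>g. is_inverse C f g)"

definition inverse_arr :: "('o, 'm, 'z) markov_structure_scheme \<Rightarrow> 'm \<Rightarrow> 'm" ("inv\<index> _" [81] 80)
  where "inverse_arr C f = (THE g. is_inverse C f g)"

locale category =
  fixes C :: "('o, 'm, 'z) markov_structure_scheme" (structure)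
  assumes Dom_Obj: "f \<in> Arr C \<Longrightarrow> Dom C f \<in> Obj C"
    and Cod_Obj: "f \<in> Arr C \<Longrightarrow> Cod C f \<in> Obj C"
    and Id_hom: "A \<in> Obj C \<Longrightarrow> \<iota> A \<in> hom C A A"
    and Comp_hom: "f \<in> hom C A B \<Longrightarrow> g \<in> hom C B D \<Longrightarrow> g \<cdot> f \<in> hom C A D"
    and Comp_Id_left: "f \<in> hom C A B \<Longrightarrow> \<iota> B \<cdot> f = f"
    and Comp_Id_right: "f \<in> hom C A B \<Longrightarrow> f \<cdot> \<iota> A = f"
    and Comp_assoc: "f \<in> hom C A B \<Longrightarrow> g \<in> hom C B D \<Longrightarrow> h \<in> hom C D E \<Longrightarrow>
      (h \<cdot> g) \<cdot> f = h \<cdot> (g \<cdot> f)"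

locale monoidal_category = category +
  assumes Unit_Obj: "\<one> \<in> Obj C"
    and Tensor_Obj: "A \<in> Obj C \<Longrightarrow> B \<in> Obj C \<Longrightarrow> A \<otimes> B \<in> Obj C"
    and Tensor_hom: "f \<in> hom C A B \<Longrightarrow> g \<in> hom C A' B' \<Longrightarrow> f \<boxtimes> g \<in> hom C (A \<otimes> A') (B \<otimes> B')"
    and Tensor_Id: "A \<in> Obj C \<Longrightarrow> B \<in> Obj C \<Longrightarrow> \<iota> A \<boxtimes> \<iota> B = \<iota> (A \<otimes> B)"
    and Tensor_Comp: "f \<in> hom C A B \<Longrightarrow> g \<in> hom C B D \<Longrightarrow> f' \<in> hom C A' B' \<Longrightarrow> g' \<in> hom C B' D' \<Longrightarrow>
      (g \<cdot> f) \<boxtimes> (g' \<cdot> f') = (g \<boxtimes> g') \<cdot> (f \<boxtimes> f')"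
    and Assoc_hom: "A \<in> Obj C \<Longrightarrow> B \<in> Obj C \<Longrightarrow> D \<in> Obj C \<Longrightarrow>
      \<alpha> A B D \<in> hom C ((A \<otimes> B) \<otimes> D) (A \<otimes> (B \<otimes> D))"
    and Assoc_iso: "A \<in> Obj C \<Longrightarrow> B \<in> Obj C \<Longrightarrow> D \<in> Obj C \<Longrightarrow> iso C (\<alpha> A B D)"
    and Assoc_natural: "f \<in> hom C A A' \<Longrightarrow> g \<in> hom C B B' \<Longrightarrow> h \<in> hom C D D' \<Longrightarrow>
      \<alpha> A' B' D' \<cdot> ((f \<boxtimes> g) \<boxtimes> h) = (f \<boxtimes> (g \<boxtimes> h)) \<cdot> \<alpha> A B D"
    and Lunit_hom: "A \<in> Obj C \<Longrightarrow> \<ell> A \<in> hom C (\<one> \<otimes> A) A"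
    and Lunit_iso: "A \<in> Obj C \<Longrightarrow> iso C (\<ell> A)"
    and Lunit_natural: "f \<in> hom C A B \<Longrightarrow> \<ell> B \<cdot> (\<iota> \<one> \<boxtimes> f) = f \<cdot> \<ell> A"
    and Runit_hom: "A \<in> Obj C \<Longrightarrow> \<rho> A \<in> hom C (A \<otimes> \<one>) A"
    and Runit_iso: "A \<in> Obj C \<Longrightarrow> iso C (\<rho> A)"
    and Runit_natural: "f \<in> hom C A B \<Longrightarrow> \<rho> B \<cdot> (f \<boxtimes> \<iota> \<one>) = f \<cdot> \<rho> A"
    and pentagon: "A \<in> Obj C \<Longrightarrow> B \<in> Obj C \<Longrightarrow> D \<in> Obj C \<Longrightarrow> E \<in> Obj C \<Longrightarrow>
      \<alpha> A B (D \<otimes> E) \<cdot> \<alpha> (A \<otimes> B) D E =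
      (\<iota> A \<boxtimes> \<alpha> B D E) \<cdot> \<alpha> A (B \<otimes> D) E \<cdot> (\<alpha> A B D \<boxtimes> \<iota> E)"
    and triangle: "A \<in> Obj C \<Longrightarrow> B \<in> Obj C \<Longrightarrow>
      (\<iota> A \<boxtimes> \<ell> B) \<cdot> \<alpha> A \<one> B = \<rho> A \<boxtimes> \<iota> B"

locale symmetric_monoidal_category = monoidal_category +
  assumes Sym_hom: "A \<in> Obj C \<Longrightarrow> B \<in> Obj C \<Longrightarrow> \<sigma> A B \<in> hom C (A \<otimes> B) (B \<otimes> A)"
    and Sym_natural: "f \<in> hom C A A' \<Longrightarrow> g \<in> hom C B B' \<Longrightarrow>
      \<sigma> A' B' \<cdot> (f \<boxtimes> g) = (g \<boxtimes> f) \<cdot> \<sigma> A B"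
    and Sym_Sym: "A \<in> Obj C \<Longrightarrow> B \<in> Obj C \<Longrightarrow> \<sigma> B A \<cdot> \<sigma> A B = \<iota> (A \<otimes> B)"
    and hexagon: "A \<in> Obj C \<Longrightarrow> B \<in> Obj C \<Longrightarrow> D \<in> Obj C \<Longrightarrow>
      \<alpha> B D A \<cdot> \<sigma> A (B \<otimes> D) \<cdot> \<alpha> A B D =
      (\<iota> B \<boxtimes> \<sigma> A D) \<cdot> \<alpha> B A D \<cdot> (\<sigma> A B \<boxtimes> \<iota> D)"

text \<open>The interchange \<open>(X \<otimes> X) \<otimes> (Y \<otimes> Y) \<rightarrow> (X \<otimes> Y) \<otimes> (X \<otimes> Y)\<close> of the two middle factors.\<close>

definition middle_swap :: "('o, 'm, 'z) markov_structure_scheme \<Rightarrow> 'o \<Rightarrow> 'o \<Rightarrow> 'm" where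
  "middle_swap C X Y =
     inv (\<alpha> X Y (X \<otimes> Y)) \<cdot>
     (\<iota> X \<boxtimes> (\<alpha> Y X Y \<cdot> (\<sigma> X Y \<boxtimes> \<iota> Y) \<cdot> inv (\<alpha> X Y Y))) \<cdot>
     \<alpha> X X (Y \<otimes> Y)" for C (structure)

locale markov_category = symmetric_monoidal_category +
  assumes Unit_terminal: "A \<in> Obj C \<Longrightarrow> \<exists>!u. u \<in> hom C A \<one>"
    and Copy_hom: "A \<in> Obj C \<Longrightarrow> copy A \<in> hom C A (A \<otimes> A)"
    and Del_hom: "A \<in> Obj C \<Longrightarrow> del A \<in> hom C A \<one>"
    and Copy_coassoc: "A \<in> Obj C \<Longrightarrow>
      \<alpha> A A A \<cdot> (copy A \<boxtimes> \<iota> A) \<cdot> copy A = (\<iota> A \<boxtimes> copy A) \<cdot> copy A"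
    and Copy_counit_left: "A \<in> Obj C \<Longrightarrow> \<ell> A \<cdot> (del A \<boxtimes> \<iota> A) \<cdot> copy A = \<iota> A"
    and Copy_counit_right: "A \<in> Obj C \<Longrightarrow> \<rho> A \<cdot> (\<iota> A \<boxtimes> del A) \<cdot> copy A = \<iota> A"
    and Copy_commutative: "A \<in> Obj C \<Longrightarrow> \<sigma> A A \<cdot> copy A = copy A"
    and Copy_Tensor: "A \<in> Obj C \<Longrightarrow> B \<in> Obj C \<Longrightarrow>
      copy (A \<otimes> B) = middle_swap C A B \<cdot> (copy A \<boxtimes> copy B)"
    and Del_Tensor: "A \<in> Obj C \<Longrightarrow> B \<in> Obj C \<Longrightarrow>
      del (A \<otimes> B) = \<ell> \<one> \<cdot> (del A \<boxtimes> del B)"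

definition deterministic :: "('o, 'm, 'z) markov_structure_scheme \<Rightarrow> 'o \<Rightarrow> 'o \<Rightarrow> 'm \<Rightarrow> bool" where
  "deterministic C A X f \<longleftrightarrow> f \<in> hom C A X \<and> copy X \<cdot> f = (f \<boxtimes> f) \<cdot> copy A" for C (structure)

definition marginal_snd :: "('o, 'm, 'z) markov_structure_scheme \<Rightarrow> 'o \<Rightarrow> 'o \<Rightarrow> 'm \<Rightarrow> 'm" where
  "marginal_snd C X Y f = \<ell> Y \<cdot> (del X \<boxtimes> \<iota> Y) \<cdot> f" for C (structure)

text \<open>\<open>h : A \<otimes> Y \<rightarrow> X\<close> is a conditional of \<open>f : A \<rightarrow> X \<otimes> Y\<close> with respect to \<open>Y\<close>.\<close>

definition is_conditional ::
    "('o, 'm, 'z) markov_structure_scheme \<Rightarrow> 'o \<Rightarrow> 'o \<Rightarrow> 'o \<Rightarrow> 'm \<Rightarrow> 'm \<Rightarrow> bool" where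
  "is_conditional C A X Y f h \<longleftrightarrow>
     f \<in> hom C A (X \<otimes> Y) \<and> h \<in> hom C (A \<otimes> Y) X \<and>
     f = (h \<boxtimes> \<iota> Y) \<cdot> inv (\<alpha> A Y Y) \<cdot> (\<iota> A \<boxtimes> copy Y) \<cdot>
         (\<iota> A \<boxtimes> marginal_snd C X Y f) \<cdot> copy A" for C (structure)

definition has_conditionals :: "('o, 'm, 'z) markov_structure_scheme \<Rightarrow> bool" where
  "has_conditionals C \<longleftrightarrow> (\<forall>A \<in> Obj C. \<forall>X \<in> Obj C. \<forall>Y \<in> Obj C.
     \<forall>f \<in> hom C A (X \<otimes> Y). \<exists>h. is_conditional C A X Y f h)" for C (structure)

text \<open>
  A conditional of a state has domain \<open>\<one> \<otimes> Y\<close>, which is identified with \<open>Y\<close> along the unitor.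
\<close>

definition is_state_conditional ::
    "('o, 'm, 'z) markov_structure_scheme \<Rightarrow> 'o \<Rightarrow> 'o \<Rightarrow> 'm \<Rightarrow> 'm \<Rightarrow> bool" where
  "is_state_conditional C X Y s c \<longleftrightarrow>
     c \<in> hom C Y X \<and> is_conditional C \<one> X Y s (c \<cdot> \<ell> Y)" for C (structure)

text \<open>
  Iterated tensor products are bracketed to the left and start from the unit: the product of the
  first \<open>k\<close> objects \<open>A\<^sub>0, \<dots>, A\<^bsub>k-1\<^esub>\<close> is \<open>((\<one> \<otimes> A\<^sub>0) \<otimes> \<dots>) \<otimes> A\<^bsub>k-1\<^esub>\<close>. Hence the product over
  \<open>{0, \<dots>, t}\<close> is obtained with \<open>k = Suc t\<close>.
\<close>

primrec tensor_objs :: "('o, 'm, 'z) markov_structure_scheme \<Rightarrow> (nat \<Rightarrow> 'o) \<Rightarrow> nat \<Rightarrow> 'o" where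
  "tensor_objs C A 0 = \<one>\<^bsub>C\<^esub>"
| "tensor_objs C A (Suc k) = tensor_objs C A k \<otimes>\<^bsub>C\<^esub> A k"

primrec tensor_arrs :: "('o, 'm, 'z) markov_structure_scheme \<Rightarrow> (nat \<Rightarrow> 'm) \<Rightarrow> nat \<Rightarrow> 'm" where
  "tensor_arrs C u 0 = \<iota>\<^bsub>C\<^esub> \<one>\<^bsub>C\<^esub>"
| "tensor_arrs C u (Suc k) = tensor_arrs C u k \<boxtimes>\<^bsub>C\<^esub> u k"

text \<open>The state \<open>y\<^sub>0 \<otimes> \<dots> \<otimes> y\<^bsub>k-1\<^esub>\<close>, with the domain \<open>\<one> \<otimes> \<dots> \<otimes> \<one>\<close> identified with \<open>\<one>\<close>.\<close>

primrec tensor_states :: "('o, 'm, 'z) markov_structure_scheme \<Rightarrow> (nat \<Rightarrow> 'm) \<Rightarrow> nat \<Rightarrow> 'm" where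
  "tensor_states C y 0 = \<iota>\<^bsub>C\<^esub> \<one>\<^bsub>C\<^esub>"
| "tensor_states C y (Suc k) = (tensor_states C y k \<boxtimes>\<^bsub>C\<^esub> y k) \<cdot>\<^bsub>C\<^esub> inv\<^bsub>C\<^esub> (\<ell>\<^bsub>C\<^esub> \<one>\<^bsub>C\<^esub>)"

text \<open>\<open>X\<^bsub>t-1\<^esub>\<close>, with \<open>X\<^bsub>-1\<^esub> = \<one>\<close>.\<close>

definition prev_obj :: "('o, 'm, 'z) markov_structure_scheme \<Rightarrow> (nat \<Rightarrow> 'o) \<Rightarrow> nat \<Rightarrow> 'o" where
  "prev_obj C X t = (case t of 0 \<Rightarrow> \<one>\<^bsub>C\<^esub> | Suc s \<Rightarrow> X s)"

text \<open>The joint state \<open>m\<^sub>t : \<one> \<rightarrow> X\<^sub>0 \<otimes> \<dots> \<otimes> X\<^sub>t\<close> of the hidden process.\<close>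

primrec hidden_state ::
    "('o, 'm, 'z) markov_structure_scheme \<Rightarrow> (nat \<Rightarrow> 'o) \<Rightarrow> (nat \<Rightarrow> 'm) \<Rightarrow> nat \<Rightarrow> 'm" where
  "hidden_state C X f 0 = inv\<^bsub>C\<^esub> (\<ell>\<^bsub>C\<^esub> (X 0)) \<cdot>\<^bsub>C\<^esub> f 0"
| "hidden_state C X f (Suc t) =
     inv\<^bsub>C\<^esub> (\<alpha>\<^bsub>C\<^esub> (tensor_objs C X t) (X t) (X (Suc t))) \<cdot>\<^bsub>C\<^esub>
     (\<iota>\<^bsub>C\<^esub> (tensor_objs C X t) \<boxtimes>\<^bsub>C\<^esub>
       ((\<iota>\<^bsub>C\<^esub> (X t) \<boxtimes>\<^bsub>C\<^esub> f (Suc t)) \<cdot>\<^bsub>C\<^esub> copy\<^bsub>C\<^esub> (X t))) \<cdot>\<^bsub>C\<^esub>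
     hidden_state C X f t"

text \<open>The hidden Markov model as a state \<open>p : \<one> \<rightarrow> (X\<^sub>0 \<otimes> Y\<^sub>0) \<otimes> \<dots> \<otimes> (X\<^sub>n \<otimes> Y\<^sub>n)\<close>.\<close>

definition hidden_markov_model ::
    "('o, 'm, 'z) markov_structure_scheme \<Rightarrow> (nat \<Rightarrow> 'o) \<Rightarrow> (nat \<Rightarrow> 'm) \<Rightarrow> (nat \<Rightarrow> 'm) \<Rightarrow> nat \<Rightarrow> 'm" where
  "hidden_markov_model C X f g n =
     tensor_arrs C (\<lambda>t. (\<iota> (X t) \<boxtimes> g t) \<cdot> copy (X t)) (Suc n) \<cdot> hidden_state C X f n" for C (structure)

text \<open>
  The projection \<open>A\<^sub>0 \<otimes> \<dots> \<otimes> A\<^bsub>k+j-1\<^esub> \<rightarrow> A\<^sub>0 \<otimes> \<dots> \<otimes> A\<^bsub>k-1\<^esub>\<close> that discards the last \<open>j\<close> factors.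
\<close>

primrec discard_last ::
    "('o, 'm, 'z) markov_structure_scheme \<Rightarrow> (nat \<Rightarrow> 'o) \<Rightarrow> nat \<Rightarrow> nat \<Rightarrow> 'm" where
  "discard_last C A k 0 = \<iota>\<^bsub>C\<^esub> (tensor_objs C A k)"
| "discard_last C A k (Suc j) =
     discard_last C A k j \<cdot>\<^bsub>C\<^esub> \<rho>\<^bsub>C\<^esub> (tensor_objs C A (k + j)) \<cdot>\<^bsub>C\<^esub>
     (\<iota>\<^bsub>C\<^esub> (tensor_objs C A (k + j)) \<boxtimes>\<^bsub>C\<^esub> del\<^bsub>C\<^esub> (A (k + j)))"

text \<open>
  The marginal \<open>\<one> \<rightarrow> Y\<^bsub>[t]\<^esub> \<otimes> X\<^sub>t\<close> of a state \<open>p : \<one> \<rightarrow> (X\<^sub>0 \<otimes> Y\<^sub>0) \<otimes> \<dots> \<otimes> (X\<^sub>n \<otimes> Y\<^sub>n)\<close>, for \<open>t \<le> n\<close>: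
  discard everything after time \<open>t\<close>, then \<open>X\<^sub>0, \<dots>, X\<^bsub>t-1\<^esub>\<close>, and finally exchange \<open>X\<^sub>t\<close> and \<open>Y\<^sub>t\<close>.
\<close>

definition filter_marginal ::
    "('o, 'm, 'z) markov_structure_scheme \<Rightarrow> (nat \<Rightarrow> 'o) \<Rightarrow> (nat \<Rightarrow> 'o) \<Rightarrow> nat \<Rightarrow> 'm \<Rightarrow> nat \<Rightarrow> 'm" where
  "filter_marginal C X Y n p t =
     inv (\<alpha> (tensor_objs C Y t) (Y t) (X t)) \<cdot>
     (tensor_arrs C (\<lambda>s. \<ell> (Y s) \<cdot> (del (X s) \<boxtimes> \<iota> (Y s))) t \<boxtimes> \<sigma> (X t) (Y t)) \<cdot>
     discard_last C (\<lambda>s. X s \<otimes> Y s) (Suc t) (n - t) \<cdot> p" for C (structure)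

text \<open>
  \<open>b : Y\<^bsub>[t]\<^esub> \<rightarrow> X\<^sub>t\<close> is a version of the Bayes filter of \<open>p\<close> at time \<open>t\<close>. The symmetry moves the
  conditioned factor \<open>Y\<^bsub>[t]\<^esub>\<close> to the right, as \<^const>\<open>is_state_conditional\<close> expects.
\<close>

definition is_bayes_filter ::
    "('o, 'm, 'z) markov_structure_scheme \<Rightarrow> (nat \<Rightarrow> 'o) \<Rightarrow> (nat \<Rightarrow> 'o) \<Rightarrow> nat \<Rightarrow> 'm \<Rightarrow> nat \<Rightarrow> 'm \<Rightarrow> bool" where
  "is_bayes_filter C X Y n p t b \<longleftrightarrow>
     is_state_conditional C (X t) (tensor_objs C Y (Suc t))
       (\<sigma> (tensor_objs C Y (Suc t)) (X t) \<cdot> filter_marginal C X Y n p t) b" for C (structure)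

text \<open>
  The instantiation at \<open>y\<^sub>0, \<dots>, y\<^sub>t\<close> of a family \<open>BF\<close> of versions of the Bayes filter, and the same
  one time step earlier, where the value before time \<open>0\<close> is \<open>id : \<one> \<rightarrow> \<one>\<close>.
\<close>

definition IBF ::
    "('o, 'm, 'z) markov_structure_scheme \<Rightarrow> (nat \<Rightarrow> 'm) \<Rightarrow> (nat \<Rightarrow> 'm) \<Rightarrow> nat \<Rightarrow> 'm" where
  "IBF C BF y t = BF t \<cdot> tensor_states C y (Suc t)" for C (structure)

definition prev_IBF ::
    "('o, 'm, 'z) markov_structure_scheme \<Rightarrow> (nat \<Rightarrow> 'm) \<Rightarrow> (nat \<Rightarrow> 'm) \<Rightarrow> nat \<Rightarrow> 'm" where
  "prev_IBF C BF y t = (case t of 0 \<Rightarrow> \<iota> \<one> | Suc s \<Rightarrow> IBF C BF y s)" for C (structure)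

end

theory Submission
  imports Defs
begin

text \<open>
  Let \<open>b\<close> be a version of the Bayes filter at time \<open>t - 1\<close> and \<open>A = Y\<^bsub>[t-1]\<^esub>\<close>. Since the model is Markov,
  the joint state of \<open>Y\<^bsub>[t-1]\<^esub>\<close>, \<open>X\<^sub>t\<close> and \<open>Y\<^sub>t\<close> arises from the marginal on \<open>A\<close> by copying and applying
  \<open>\<phi> = (id \<otimes> g\<^sub>t) \<circ> copy \<circ> f\<^sub>t \<circ> b\<close> to one copy. Hence a conditional \<open>h : A \<otimes> Y\<^sub>t \<rightarrow> X\<^sub>t\<close> of \<open>\<phi>\<close> with respect
  to \<open>Y\<^sub>t\<close> is a version of the Bayes filter at time \<open>t\<close>. Copying commutes with a deterministic state
  \<open>s\<close> of \<open>A\<close>, so instantiating the first input of \<open>h\<close> at \<open>s = y\<^sub>0 \<otimes> \<dots> \<otimes> y\<^bsub>t-1\<^esub>\<close> gives a conditional of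
  \<open>\<phi> \<circ> s\<close>, and instantiating the second one at \<open>y\<^sub>t\<close> gives the claimed formula.
\<close>

lemma tensor_arrs_cong: "(\<And>i. i < k \<Longrightarrow> u i = v i) \<Longrightarrow> tensor_arrs C u k = tensor_arrs C v k"
  by (induction k) simp_all

lemma tensor_states_cong: "(\<And>i. i < k \<Longrightarrow> y i = z i) \<Longrightarrow> tensor_states C y k = tensor_states C z k"
  by (induction k) simp_all

section \<open>Categories: typing, right-nested composites, inverses and cancellation\<close>

context category
begin

lemma hom_iff [simp]: "f \<in> hom C A B \<longleftrightarrow> f \<in> Arr C \<and> Dom C f = A \<and> Cod C f = B"
  by (simp add: hom_def)

lemma Dom_in_Obj [simp]: "f \<in> Arr C \<Longrightarrow> Dom C f \<in> Obj C"
  and Cod_in_Obj [simp]: "f \<in> Arr C \<Longrightarrow> Cod C f \<in> Obj C"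
  by (fact Dom_Obj Cod_Obj)+

lemma Id_simps [simp]:
  assumes "A \<in> Obj C"
  shows "\<iota> A \<in> Arr C" "Dom C (\<iota> A) = A" "Cod C (\<iota> A) = A"
  using Id_hom[OF assms] by simp_all

lemma Comp_simps [simp]:
  assumes "f \<in> Arr C" "g \<in> Arr C" "Dom C g = Cod C f"
  shows "g \<cdot> f \<in> Arr C" "Dom C (g \<cdot> f) = Dom C f" "Cod C (g \<cdot> f) = Cod C g"
  using Comp_hom[of f "Dom C f" "Cod C f" g "Cod C g"] assms by simp_all

lemma Id_Comp [simp]: "f \<in> Arr C \<Longrightarrow> Cod C f = B \<Longrightarrow> \<iota> B \<cdot> f = f"
  and Comp_Id [simp]: "f \<in> Arr C \<Longrightarrow> Dom C f = A \<Longrightarrow> f \<cdot> \<iota> A = f"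
  using Comp_Id_left[of f "Dom C f" B] Comp_Id_right[of f A "Cod C f"] by simp_all

lemma Comp_assoc_simp [simp]:
  "\<lbrakk>f \<in> Arr C; g \<in> Arr C; h \<in> Arr C; Dom C g = Cod C f; Dom C h = Cod C g\<rbrakk> \<Longrightarrow>
    (h \<cdot> g) \<cdot> f = h \<cdot> g \<cdot> f"
  using Comp_assoc by simp

text \<open>Composites are kept nested to the right, so \<open>g \<cdot> f\<close> is not a subterm
  once a further factor \<open>e\<close> precedes it. This form lets an equation between two-fold
  composites act inside a longer chain.\<close>

lemma Comp_cong_prefix:
  assumes "g \<cdot> f = k" "f \<in> Arr C" "g \<in> Arr C" "Dom C g = Cod C f" "e \<in> Arr C" "Cod C e = Dom C f"
  shows "g \<cdot> f \<cdot> e = k \<cdot> e"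
  using assms Comp_assoc_simp[of e f g] by simp

lemma is_inverse_unique:
  assumes "is_inverse C f g" "is_inverse C f g'"
  shows "g = g'"
proof -
  have "g = (g' \<cdot> f) \<cdot> g"
    using assms by (simp add: is_inverse_def del: Comp_assoc_simp)
  also have "\<dots> = g' \<cdot> f \<cdot> g"
    using assms by (intro Comp_assoc_simp) (simp_all add: is_inverse_def)
  also have "\<dots> = g'"
    using assms by (simp add: is_inverse_def)
  finally show ?thesis .
qed

lemma is_inverse_inverse_arr: "iso C f \<Longrightarrow> is_inverse C f (inv f)"
  unfolding iso_def inverse_arr_def by (blast intro: theI is_inverse_unique)

lemma inverse_simps [simp]:
  assumes "iso C f"
  shows "inv f \<in> Arr C" "Dom C (inv f) = Cod C f" "Cod C (inv f) = Dom C f"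
    "inv f \<cdot> f = \<iota> (Dom C f)" "f \<cdot> inv f = \<iota> (Cod C f)"
  using is_inverse_inverse_arr[OF assms] by (simp_all add: is_inverse_def)

lemma iso_Arr: "iso C f \<Longrightarrow> f \<in> Arr C"
  by (auto simp: iso_def is_inverse_def)

lemma inverse_Comp_prefix [simp]:
  assumes "iso C f" "e \<in> Arr C"
  shows "Cod C e = Dom C f \<Longrightarrow> inv f \<cdot> f \<cdot> e = e" "Cod C e = Cod C f \<Longrightarrow> f \<cdot> inv f \<cdot> e = e"
  using assms iso_Arr[OF assms(1)]
  by (simp_all add: Comp_assoc_simp[symmetric] del: Comp_assoc_simp)

lemma iso_cancel_left:
  assumes "iso C h" "h \<cdot> f = h \<cdot> g" "f \<in> Arr C" "g \<in> Arr C" "Cod C f = Dom C h" "Cod C g = Dom C h"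
  shows "f = g"
  by (metis assms inverse_Comp_prefix(1))

lemma iso_cancel_right:
  assumes "iso C h" "f \<cdot> h = g \<cdot> h" "f \<in> Arr C" "g \<in> Arr C" "Dom C f = Cod C h" "Dom C g = Cod C h"
  shows "f = g"
proof -
  have "(f \<cdot> h) \<cdot> inv h = (g \<cdot> h) \<cdot> inv h"
    using assms(2) by simp
  then show ?thesis
    using assms(1,3-) iso_Arr[OF assms(1)] by simp
qed

lemma isoI:
  assumes "f \<in> Arr C" "g \<in> Arr C" "Dom C g = Cod C f" "Cod C g = Dom C f"
    "g \<cdot> f = \<iota> (Dom C f)" "f \<cdot> g = \<iota> (Cod C f)"
  shows "iso C f"
  using assms unfolding iso_def is_inverse_def by (intro exI[of _ g]) simp

lemma iso_Comp:
  assumes "iso C f" "iso C g" "Dom C g = Cod C f"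
  shows "iso C (g \<cdot> f)"
  using assms iso_Arr[of f] iso_Arr[of g]
  by (intro isoI[of _ "inv f \<cdot> inv g"]) simp_all

end

section \<open>Monoidal categories: interchange, naturality and the derived unit laws\<close>

context monoidal_category
begin

lemma Unit_in_Obj [simp]: "\<one> \<in> Obj C"
  and Tensor_in_Obj [simp]: "A \<in> Obj C \<Longrightarrow> B \<in> Obj C \<Longrightarrow> A \<otimes> B \<in> Obj C"
  by (fact Unit_Obj Tensor_Obj)+

lemma Tensor_simps [simp]:
  assumes "f \<in> Arr C" "g \<in> Arr C"
  shows "f \<boxtimes> g \<in> Arr C" "Dom C (f \<boxtimes> g) = Dom C f \<otimes> Dom C g" "Cod C (f \<boxtimes> g) = Cod C f \<otimes> Cod C g"
  using Tensor_hom[of f "Dom C f" "Cod C f" g "Dom C g" "Cod C g"] assms by simp_all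

declare Tensor_Id [simp]

text \<open>Read from left to right, adjacent tensor products merge into one. Arguments that need
  the factors apart, such as those through the pentagon, suspend this rule.\<close>

lemma interchange [simp]:
  assumes "f \<in> Arr C" "g \<in> Arr C" "f' \<in> Arr C" "g' \<in> Arr C" "Dom C g = Cod C f" "Dom C g' = Cod C f'"
  shows "(g \<boxtimes> g') \<cdot> (f \<boxtimes> f') = (g \<cdot> f) \<boxtimes> (g' \<cdot> f')"
  using Tensor_Comp[of f "Dom C f" "Cod C f" g "Cod C g" f' "Dom C f'" "Cod C f'" g' "Cod C g'"] assms
  by simp

lemma interchange_prefix [simp]:
  assumes "f \<in> Arr C" "g \<in> Arr C" "f' \<in> Arr C" "g' \<in> Arr C" "Dom C g = Cod C f" "Dom C g' = Cod C f'"
    "e \<in> Arr C" "Cod C e = Dom C f \<otimes> Dom C f'"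
  shows "(g \<boxtimes> g') \<cdot> (f \<boxtimes> f') \<cdot> e = ((g \<cdot> f) \<boxtimes> (g' \<cdot> f')) \<cdot> e"
  using assms by (subst Comp_cong_prefix[OF interchange]) simp_all

lemma Assoc_simps [simp]:
  assumes "A \<in> Obj C" "B \<in> Obj C" "D \<in> Obj C"
  shows "\<alpha> A B D \<in> Arr C" "Dom C (\<alpha> A B D) = (A \<otimes> B) \<otimes> D" "Cod C (\<alpha> A B D) = A \<otimes> B \<otimes> D"
  using Assoc_hom[OF assms] by simp_all

lemma Unitor_simps [simp]:
  assumes "A \<in> Obj C"
  shows "\<ell> A \<in> Arr C" "Dom C (\<ell> A) = \<one> \<otimes> A" "Cod C (\<ell> A) = A"
    "\<rho> A \<in> Arr C" "Dom C (\<rho> A) = A \<otimes> \<one>" "Cod C (\<rho> A) = A"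
  using Lunit_hom[OF assms] Runit_hom[OF assms] by simp_all

declare Assoc_iso [simp] Lunit_iso [simp] Runit_iso [simp]

lemma iso_Tensor [simp]:
  assumes "iso C f" "iso C g"
  shows "iso C (f \<boxtimes> g)"
  using assms iso_Arr[of f] iso_Arr[of g]
  by (intro isoI[of _ "inv f \<boxtimes> inv g"]) simp_all

lemma iso_Id: "A \<in> Obj C \<Longrightarrow> iso C (\<iota> A)"
  by (intro isoI[of _ "\<iota> A"]) simp_all

text \<open>The codomains are separate variables tied by equations, so that the associator is
  recognised however its objects are written.\<close>

lemma Assoc_nat:
  assumes "f \<in> Arr C" "g \<in> Arr C" "h \<in> Arr C" "Cod C f = A'" "Cod C g = B'" "Cod C h = D'"
  shows "\<alpha> A' B' D' \<cdot> ((f \<boxtimes> g) \<boxtimes> h) = (f \<boxtimes> (g \<boxtimes> h)) \<cdot> \<alpha> (Dom C f) (Dom C g) (Dom C h)"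
  using assms by (intro Assoc_natural) auto

lemma Assoc_inv_nat:
  assumes "f \<in> Arr C" "g \<in> Arr C" "h \<in> Arr C" "Cod C f = A'" "Cod C g = B'" "Cod C h = D'"
  shows "inv (\<alpha> A' B' D') \<cdot> (f \<boxtimes> (g \<boxtimes> h)) =
    ((f \<boxtimes> g) \<boxtimes> h) \<cdot> inv (\<alpha> (Dom C f) (Dom C g) (Dom C h))"
proof -
  have [simp]: "A' \<in> Obj C" "B' \<in> Obj C" "D' \<in> Obj C"
    using assms by auto
  show ?thesis
    by (rule iso_cancel_left[of "\<alpha> A' B' D'"])
      (use assms in \<open>simp_all add: Comp_cong_prefix[OF Assoc_nat]\<close>)
qed

lemma Lunit_nat:
  assumes "f \<in> Arr C" "Cod C f = B"
  shows "\<ell> B \<cdot> (\<iota> \<one> \<boxtimes> f) = f \<cdot> \<ell> (Dom C f)"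
  using assms by (intro Lunit_natural) auto

lemma Lunit_inv_nat:
  assumes "f \<in> Arr C" "Cod C f = B"
  shows "inv (\<ell> B) \<cdot> f = (\<iota> \<one> \<boxtimes> f) \<cdot> inv (\<ell> (Dom C f))"
proof -
  have [simp]: "B \<in> Obj C"
    using assms by auto
  show ?thesis
    by (rule iso_cancel_left[of "\<ell> B"])
      (use assms in \<open>simp_all add: Comp_cong_prefix[OF Lunit_nat]\<close>)
qed

lemma Runit_nat:
  assumes "f \<in> Arr C" "Cod C f = B"
  shows "\<rho> B \<cdot> (f \<boxtimes> \<iota> \<one>) = f \<cdot> \<rho> (Dom C f)"
  using assms by (intro Runit_natural) auto

text \<open>Tensoring with the unit is faithful, because the unitor is a natural isomorphism from
  that functor to the identity functor.\<close>

lemma Tensor_Unit_cancel_right: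
  assumes "f \<boxtimes> \<iota> \<one> = g \<boxtimes> \<iota> \<one>" "f \<in> hom C A B" "g \<in> hom C A B"
  shows "f = g"
proof -
  have "f \<cdot> \<rho> A = g \<cdot> \<rho> A"
    using assms Runit_natural[of f A B] Runit_natural[of g A B] by simp
  then show ?thesis
    by (rule iso_cancel_right[rotated]) (use assms in auto)
qed

lemma Tensor_Unit_cancel_left:
  assumes "\<iota> \<one> \<boxtimes> f = \<iota> \<one> \<boxtimes> g" "f \<in> hom C A B" "g \<in> hom C A B"
  shows "f = g"
proof -
  have "f \<cdot> \<ell> A = g \<cdot> \<ell> A"
    using assms Lunit_natural[of f A B] Lunit_natural[of g A B] by simp
  then show ?thesis
    by (rule iso_cancel_right[rotated]) (use assms in auto)
qed

text \<open>Kelly's unit law. Tensored with \<open>\<iota> \<one>\<close> and followed by an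
  associator, it reduces to two triangles joined by the pentagon; both additions can be
  cancelled.\<close>

lemma Runit_Tensor:
  assumes [simp]: "A \<in> Obj C" "B \<in> Obj C"
  shows "\<rho> (A \<otimes> B) = (\<iota> A \<boxtimes> \<rho> B) \<cdot> \<alpha> A B \<one>"
proof (rule Tensor_Unit_cancel_right)
  show "\<rho> (A \<otimes> B) \<boxtimes> \<iota> \<one> = ((\<iota> A \<boxtimes> \<rho> B) \<cdot> \<alpha> A B \<one>) \<boxtimes> \<iota> \<one>"
  proof (rule iso_cancel_left[of "\<alpha> A B \<one>"])
    have "\<alpha> A B \<one> \<cdot> (\<rho> (A \<otimes> B) \<boxtimes> \<iota> \<one>) =
        \<alpha> A B \<one> \<cdot> ((\<iota> A \<boxtimes> \<iota> B) \<boxtimes> \<ell> \<one>) \<cdot> \<alpha> (A \<otimes> B) \<one> \<one>"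
      using triangle[of "A \<otimes> B" \<one>] by simp
    also have "\<dots> = (\<iota> A \<boxtimes> (\<iota> B \<boxtimes> \<ell> \<one>)) \<cdot> \<alpha> A B (\<one> \<otimes> \<one>) \<cdot> \<alpha> (A \<otimes> B) \<one> \<one>"
      by (subst Comp_cong_prefix[OF Assoc_nat]) (simp_all del: Tensor_Id)
    also have "\<dots> = (\<iota> A \<boxtimes> ((\<iota> B \<boxtimes> \<ell> \<one>) \<cdot> \<alpha> B \<one> \<one>)) \<cdot> \<alpha> A (B \<otimes> \<one>) \<one> \<cdot> (\<alpha> A B \<one> \<boxtimes> \<iota> \<one>)"
      by (simp add: pentagon)
    also have "\<dots> = (\<iota> A \<boxtimes> (\<rho> B \<boxtimes> \<iota> \<one>)) \<cdot> \<alpha> A (B \<otimes> \<one>) \<one> \<cdot> (\<alpha> A B \<one> \<boxtimes> \<iota> \<one>)"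
      by (simp add: triangle)
    also have "\<dots> = \<alpha> A B \<one> \<cdot> ((\<iota> A \<boxtimes> \<rho> B) \<boxtimes> \<iota> \<one>) \<cdot> (\<alpha> A B \<one> \<boxtimes> \<iota> \<one>)"
      by (subst Comp_cong_prefix[OF Assoc_nat]) simp_all
    finally show "\<alpha> A B \<one> \<cdot> (\<rho> (A \<otimes> B) \<boxtimes> \<iota> \<one>) =
        \<alpha> A B \<one> \<cdot> (((\<iota> A \<boxtimes> \<rho> B) \<cdot> \<alpha> A B \<one>) \<boxtimes> \<iota> \<one>)"
      by simp
  qed simp_all
qed simp_all

text \<open>The mirror image of \<open>Runit_Tensor\<close>: tensor with
  \<open>\<iota> \<one>\<close> on the left, precompose with the isomorphism that completes the
  pentagon, and cancel.\<close>

lemma Lunit_Tensor: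
  assumes [simp]: "A \<in> Obj C" "B \<in> Obj C"
  shows "\<ell> (A \<otimes> B) \<cdot> \<alpha> \<one> A B = \<ell> A \<boxtimes> \<iota> B"
proof (rule Tensor_Unit_cancel_left)
  show "\<iota> \<one> \<boxtimes> (\<ell> (A \<otimes> B) \<cdot> \<alpha> \<one> A B) = \<iota> \<one> \<boxtimes> (\<ell> A \<boxtimes> \<iota> B)"
  proof (rule iso_cancel_right[of "\<alpha> \<one> (\<one> \<otimes> A) B \<cdot> (\<alpha> \<one> \<one> A \<boxtimes> \<iota> B)"])
    have "(\<iota> \<one> \<boxtimes> (\<ell> (A \<otimes> B) \<cdot> \<alpha> \<one> A B)) \<cdot> \<alpha> \<one> (\<one> \<otimes> A) B \<cdot> (\<alpha> \<one> \<one> A \<boxtimes> \<iota> B) =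
        (\<iota> \<one> \<boxtimes> \<ell> (A \<otimes> B)) \<cdot> (\<iota> \<one> \<boxtimes> \<alpha> \<one> A B) \<cdot> \<alpha> \<one> (\<one> \<otimes> A) B \<cdot> (\<alpha> \<one> \<one> A \<boxtimes> \<iota> B)"
      by simp
    also have "\<dots> = (\<iota> \<one> \<boxtimes> \<ell> (A \<otimes> B)) \<cdot> \<alpha> \<one> \<one> (A \<otimes> B) \<cdot> \<alpha> (\<one> \<otimes> \<one>) A B"
      by (simp add: pentagon del: interchange interchange_prefix)
    also have "\<dots> = (\<rho> \<one> \<boxtimes> (\<iota> A \<boxtimes> \<iota> B)) \<cdot> \<alpha> (\<one> \<otimes> \<one>) A B"
      by (subst Comp_cong_prefix[OF triangle]) simp_all
    also have "\<dots> = \<alpha> \<one> A B \<cdot> ((\<rho> \<one> \<boxtimes> \<iota> A) \<boxtimes> \<iota> B)"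
      by (simp add: Assoc_nat del: Tensor_Id)
    also have "\<dots> = \<alpha> \<one> A B \<cdot> ((\<iota> \<one> \<boxtimes> \<ell> A) \<boxtimes> \<iota> B) \<cdot> (\<alpha> \<one> \<one> A \<boxtimes> \<iota> B)"
      by (simp add: triangle)
    also have "\<dots> = (\<iota> \<one> \<boxtimes> (\<ell> A \<boxtimes> \<iota> B)) \<cdot> \<alpha> \<one> (\<one> \<otimes> A) B \<cdot> (\<alpha> \<one> \<one> A \<boxtimes> \<iota> B)"
      by (subst Comp_cong_prefix[OF Assoc_nat]) simp_all
    finally show "(\<iota> \<one> \<boxtimes> (\<ell> (A \<otimes> B) \<cdot> \<alpha> \<one> A B)) \<cdot> \<alpha> \<one> (\<one> \<otimes> A) B \<cdot> (\<alpha> \<one> \<one> A \<boxtimes> \<iota> B) =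
        (\<iota> \<one> \<boxtimes> (\<ell> A \<boxtimes> \<iota> B)) \<cdot> \<alpha> \<one> (\<one> \<otimes> A) B \<cdot> (\<alpha> \<one> \<one> A \<boxtimes> \<iota> B)" .
  qed (simp_all add: iso_Comp iso_Id)
qed simp_all

lemma tensor_objs_in_Obj [simp]: "(\<And>i. i < k \<Longrightarrow> A i \<in> Obj C) \<Longrightarrow> tensor_objs C A k \<in> Obj C"
  by (induction k) simp_all

lemma tensor_arrs_hom:
  assumes "\<And>i. i < k \<Longrightarrow> u i \<in> hom C (A i) (B i)"
  shows "tensor_arrs C u k \<in> hom C (tensor_objs C A k) (tensor_objs C B k)"
  using assms by (induction k) simp_all

lemma tensor_arrs_Comp:
  assumes "\<And>i. i < k \<Longrightarrow> u i \<in> hom C (A i) (B i)" "\<And>i. i < k \<Longrightarrow> v i \<in> hom C (B i) (D i)"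
  shows "tensor_arrs C v k \<cdot> tensor_arrs C u k = tensor_arrs C (\<lambda>i. v i \<cdot> u i) k"
  using assms
proof (induction k)
  case (Suc k)
  have "tensor_arrs C u k \<in> hom C (tensor_objs C A k) (tensor_objs C B k)"
    "tensor_arrs C v k \<in> hom C (tensor_objs C B k) (tensor_objs C D k)"
    by (intro tensor_arrs_hom; use Suc.prems in simp)+
  then show ?case
    using Suc by simp
qed simp

end

section \<open>Symmetry: the second hexagon and naturality of the middle interchange\<close>

context symmetric_monoidal_category
begin

lemma Sym_simps [simp]:
  assumes "A \<in> Obj C" "B \<in> Obj C"
  shows "\<sigma> A B \<in> Arr C" "Dom C (\<sigma> A B) = A \<otimes> B" "Cod C (\<sigma> A B) = B \<otimes> A"
  using Sym_hom[OF assms] by simp_all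

lemma Sym_nat:
  assumes "f \<in> Arr C" "g \<in> Arr C" "Cod C f = A'" "Cod C g = B'"
  shows "\<sigma> A' B' \<cdot> (f \<boxtimes> g) = (g \<boxtimes> f) \<cdot> \<sigma> (Dom C f) (Dom C g)"
  using assms by (intro Sym_natural) auto

lemma Sym_Sym_prefix [simp]:
  assumes "A \<in> Obj C" "B \<in> Obj C" "e \<in> Arr C" "Cod C e = A \<otimes> B"
  shows "\<sigma> B A \<cdot> \<sigma> A B \<cdot> e = e"
  using assms by (subst Comp_cong_prefix[OF Sym_Sym]) simp_all

declare Sym_Sym [simp]

text \<open>The hexagon for a product in the first argument of the symmetry, with the move of
  \<open>D\<close> past \<open>B\<close> undone. It follows from the assumed hexagon because the
  symmetry is its own inverse.\<close>

lemma Sym_Tensor_left: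
  assumes [simp]: "A \<in> Obj C" "B \<in> Obj C" "D \<in> Obj C"
  shows "\<sigma> (A \<otimes> B) D \<cdot> inv (\<alpha> A B D) \<cdot> (\<iota> A \<boxtimes> \<sigma> D B) =
    \<alpha> D A B \<cdot> (\<sigma> A D \<boxtimes> \<iota> B) \<cdot> inv (\<alpha> A D B)"
proof -
  \<comment> \<open>The inserted factors
    \<open>\<alpha> A D B \<cdot> (\<sigma> D A \<boxtimes> \<iota> B)\<close> and \<open>(\<sigma>
    A D \<boxtimes> \<iota> B) \<cdot> inv (\<alpha> A D B)\<close> cancel; with them the right side
    of the hexagon at \<open>D\<close>, \<open>A\<close>, \<open>B\<close> appears.\<close>
  have "\<sigma> (A \<otimes> B) D \<cdot> inv (\<alpha> A B D) \<cdot> (\<iota> A \<boxtimes> \<sigma> D B) = \<sigma> (A \<otimes> B) D \<cdot> inv (\<alpha> A B D) \<cdot>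
      ((\<iota> A \<boxtimes> \<sigma> D B) \<cdot> \<alpha> A D B \<cdot> (\<sigma> D A \<boxtimes> \<iota> B)) \<cdot> (\<sigma> A D \<boxtimes> \<iota> B) \<cdot> inv (\<alpha> A D B)"
    by simp
  also have "\<dots> = \<sigma> (A \<otimes> B) D \<cdot> inv (\<alpha> A B D) \<cdot>
      (\<alpha> A B D \<cdot> \<sigma> D (A \<otimes> B) \<cdot> \<alpha> D A B) \<cdot> (\<sigma> A D \<boxtimes> \<iota> B) \<cdot> inv (\<alpha> A D B)"
    by (subst hexagon) simp_all
  also have "\<dots> = \<alpha> D A B \<cdot> (\<sigma> A D \<boxtimes> \<iota> B) \<cdot> inv (\<alpha> A D B)"
    by simp
  finally show ?thesis .
qed

lemma middle_swap_simps [simp]: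
  assumes "A \<in> Obj C" "B \<in> Obj C"
  shows "middle_swap C A B \<in> Arr C" "Dom C (middle_swap C A B) = (A \<otimes> A) \<otimes> (B \<otimes> B)"
    "Cod C (middle_swap C A B) = (A \<otimes> B) \<otimes> (A \<otimes> B)"
  using assms by (simp_all add: middle_swap_def)

lemma middle_swap_nat:
  assumes "f \<in> hom C A A'" "g \<in> hom C B B'"
  shows "middle_swap C A' B' \<cdot> ((f \<boxtimes> f) \<boxtimes> (g \<boxtimes> g)) = ((f \<boxtimes> g) \<boxtimes> (f \<boxtimes> g)) \<cdot> middle_swap C A B"
proof -
  have [simp]: "A \<in> Obj C" "A' \<in> Obj C" "B \<in> Obj C" "B' \<in> Obj C"
    using assms by auto
  note [simp] = assms[unfolded hom_iff]
  have inner: "\<alpha> B' A' B' \<cdot> (\<sigma> A' B' \<boxtimes> \<iota> B') \<cdot> inv (\<alpha> A' B' B') \<cdot> (f \<boxtimes> (g \<boxtimes> g)) =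
      (g \<boxtimes> (f \<boxtimes> g)) \<cdot> \<alpha> B A B \<cdot> (\<sigma> A B \<boxtimes> \<iota> B) \<cdot> inv (\<alpha> A B B)"
  proof -
    have "\<alpha> B' A' B' \<cdot> (\<sigma> A' B' \<boxtimes> \<iota> B') \<cdot> inv (\<alpha> A' B' B') \<cdot> (f \<boxtimes> (g \<boxtimes> g)) =
        \<alpha> B' A' B' \<cdot> ((g \<boxtimes> f) \<boxtimes> g) \<cdot> (\<sigma> A B \<boxtimes> \<iota> B) \<cdot> inv (\<alpha> A B B)"
      by (simp add: Assoc_inv_nat Sym_nat)
    also have "\<dots> = (g \<boxtimes> (f \<boxtimes> g)) \<cdot> \<alpha> B A B \<cdot> (\<sigma> A B \<boxtimes> \<iota> B) \<cdot> inv (\<alpha> A B B)"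
      by (subst Comp_cong_prefix[OF Assoc_nat]) simp_all
    finally show ?thesis .
  qed
  have "middle_swap C A' B' \<cdot> ((f \<boxtimes> f) \<boxtimes> (g \<boxtimes> g)) = inv (\<alpha> A' B' (A' \<otimes> B')) \<cdot>
      (f \<boxtimes> (\<alpha> B' A' B' \<cdot> (\<sigma> A' B' \<boxtimes> \<iota> B') \<cdot> inv (\<alpha> A' B' B') \<cdot> (f \<boxtimes> (g \<boxtimes> g)))) \<cdot>
      \<alpha> A A (B \<otimes> B)"
    by (simp add: middle_swap_def Assoc_nat)
  also have "\<dots> = inv (\<alpha> A' B' (A' \<otimes> B')) \<cdot> (f \<boxtimes> (g \<boxtimes> (f \<boxtimes> g))) \<cdot>
      (\<iota> A \<boxtimes> (\<alpha> B A B \<cdot> (\<sigma> A B \<boxtimes> \<iota> B) \<cdot> inv (\<alpha> A B B))) \<cdot> \<alpha> A A (B \<otimes> B)"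
    by (simp add: inner)
  also have "\<dots> = ((f \<boxtimes> g) \<boxtimes> (f \<boxtimes> g)) \<cdot> middle_swap C A B"
    by (subst Comp_cong_prefix[OF Assoc_inv_nat]) (simp_all add: middle_swap_def)
  finally show ?thesis .
qed

end

section \<open>Copying, deterministic states and conditionals of states\<close>

context markov_category
begin

lemma Copy_simps [simp]:
  assumes "A \<in> Obj C"
  shows "copy A \<in> Arr C" "Dom C (copy A) = A" "Cod C (copy A) = A \<otimes> A"
  using Copy_hom[OF assms] by simp_all

lemma Del_simps [simp]:
  assumes "A \<in> Obj C"
  shows "del A \<in> Arr C" "Dom C (del A) = A" "Cod C (del A) = \<one>"
  using Del_hom[OF assms] by simp_all

declare Copy_commutative [simp]

lemma Sym_Copy_prefix [simp]:
  assumes "e \<in> Arr C" "Cod C e = A"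
  shows "\<sigma> A A \<cdot> copy A \<cdot> e = copy A \<cdot> e"
  using assms by (subst Comp_cong_prefix[OF Copy_commutative]) auto

lemma Unit_hom_unique:
  assumes "f \<in> hom C A \<one>" "g \<in> hom C A \<one>"
  shows "f = g"
  using assms Unit_terminal[of A] by auto

lemma Del_Comp [simp]:
  assumes "f \<in> Arr C" "Cod C f = B"
  shows "del B \<cdot> f = del (Dom C f)"
  by (rule Unit_hom_unique[of _ "Dom C f"]) (use assms in auto)

text \<open>An object isomorphic to the unit is terminal as well, so equations between arrows into
  it need no coherence argument.\<close>

lemma iso_Unit_hom_unique:
  assumes "iso C h" "Cod C h = \<one>" "f \<in> hom C A (Dom C h)" "g \<in> hom C A (Dom C h)"
  shows "f = g"
proof (rule iso_cancel_left[OF assms(1)])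
  show "h \<cdot> f = h \<cdot> g"
    by (rule Unit_hom_unique[of _ A]) (use assms iso_Arr in auto)
qed (use assms in auto)

lemma Copy_Unit: "copy \<one> = inv (\<ell> \<one>)"
  by (rule iso_Unit_hom_unique[of "\<ell> \<one>" _ \<one>]) simp_all

lemma Copy_Unit_Tensor:
  "middle_swap C \<one> \<one> \<cdot> (copy \<one> \<boxtimes> copy \<one>) \<cdot> copy \<one> = (copy \<one> \<boxtimes> copy \<one>) \<cdot> copy \<one>"
  by (rule iso_Unit_hom_unique[of "\<ell> \<one> \<cdot> (\<ell> \<one> \<boxtimes> \<ell> \<one>)" _ \<one>]) (simp_all add: iso_Comp)

lemma marginal_snd_simps [simp]:
  assumes "f \<in> Arr C" "Cod C f = X \<otimes> Y" "X \<in> Obj C" "Y \<in> Obj C"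
  shows "marginal_snd C X Y f \<in> Arr C" "Dom C (marginal_snd C X Y f) = Dom C f"
    "Cod C (marginal_snd C X Y f) = Y"
  using assms by (simp_all add: marginal_snd_def)

lemma marginal_snd_Comp:
  assumes "f \<in> Arr C" "Cod C f = X \<otimes> Y" "X \<in> Obj C" "Y \<in> Obj C" "e \<in> Arr C" "Cod C e = Dom C f"
  shows "marginal_snd C X Y (f \<cdot> e) = marginal_snd C X Y f \<cdot> e"
  using assms by (simp add: marginal_snd_def)

text \<open>Discarding the output of \<open>c\<close> amounts to discarding its input, and the
  counit law then removes the copy.\<close>

lemma marginal_snd_graph:
  assumes "c \<in> hom C Y X" "m \<in> hom C A Y"
  shows "marginal_snd C X Y ((c \<boxtimes> \<iota> Y) \<cdot> copy Y \<cdot> m) = m"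
proof -
  have [simp]: "X \<in> Obj C" "Y \<in> Obj C" "A \<in> Obj C"
    using assms by auto
  have "marginal_snd C X Y ((c \<boxtimes> \<iota> Y) \<cdot> copy Y \<cdot> m) = (\<ell> Y \<cdot> (del Y \<boxtimes> \<iota> Y) \<cdot> copy Y) \<cdot> m"
    using assms by (simp add: marginal_snd_def)
  then show ?thesis
    using assms by (simp add: Copy_counit_left del: Comp_assoc_simp)
qed

text \<open>With the unit as parameter, copying the parameter is an inverse unitor. The unit laws
  absorb it together with the associator, and only the graph of \<open>c\<close> over
  \<open>m\<close> remains.\<close>

lemma state_conditional_eq:
  assumes "c \<in> hom C Y X" "m \<in> hom C \<one> Y"
  shows "((c \<cdot> \<ell> Y) \<boxtimes> \<iota> Y) \<cdot> inv (\<alpha> \<one> Y Y) \<cdot> (\<iota> \<one> \<boxtimes> copy Y) \<cdot> (\<iota> \<one> \<boxtimes> m) \<cdot> copy \<one> =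
    (c \<boxtimes> \<iota> Y) \<cdot> copy Y \<cdot> m"
proof -
  have [simp]: "X \<in> Obj C" "Y \<in> Obj C"
    using assms by auto
  note [simp] = assms[unfolded hom_iff]
  have "\<ell> (Y \<otimes> Y) = (\<ell> (Y \<otimes> Y) \<cdot> \<alpha> \<one> Y Y) \<cdot> inv (\<alpha> \<one> Y Y)"
    by simp
  then have unit: "(\<ell> Y \<boxtimes> \<iota> Y) \<cdot> inv (\<alpha> \<one> Y Y) = \<ell> (Y \<otimes> Y)"
    by (simp add: Lunit_Tensor del: Comp_assoc_simp)
  have "((c \<cdot> \<ell> Y) \<boxtimes> \<iota> Y) \<cdot> inv (\<alpha> \<one> Y Y) \<cdot> (\<iota> \<one> \<boxtimes> copy Y) \<cdot> (\<iota> \<one> \<boxtimes> m) \<cdot> copy \<one> =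
      (c \<boxtimes> \<iota> Y) \<cdot> ((\<ell> Y \<boxtimes> \<iota> Y) \<cdot> inv (\<alpha> \<one> Y Y)) \<cdot> (\<iota> \<one> \<boxtimes> (copy Y \<cdot> m)) \<cdot> inv (\<ell> \<one>)"
    by (simp add: Copy_Unit)
  also have "\<dots> = (c \<boxtimes> \<iota> Y) \<cdot> copy Y \<cdot> m"
    by (simp add: unit Comp_cong_prefix[OF Lunit_nat])
  finally show ?thesis .
qed

text \<open>Together with \<open>state_conditionalE\<close> this reduces conditionals of states to
  graphs: to verify a conditional, any display over some \<open>m\<close> will do, since the
  marginal of the display is \<open>m\<close>.\<close>

lemma state_conditional_graph:
  assumes "c \<in> hom C Y X" "m \<in> hom C \<one> Y"
  shows "is_state_conditional C X Y ((c \<boxtimes> \<iota> Y) \<cdot> copy Y \<cdot> m) c"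
proof -
  have "X \<in> Obj C" "Y \<in> Obj C"
    using assms by auto
  then show ?thesis
    using assms state_conditional_eq[OF assms]
    unfolding is_state_conditional_def is_conditional_def marginal_snd_graph[OF assms] by simp
qed

text \<open>The witness \<open>m\<close> is the marginal of \<open>s\<close> on
  \<open>Y\<close>.\<close>

lemma state_conditionalE:
  assumes "is_state_conditional C X Y s c" "X \<in> Obj C" "Y \<in> Obj C"
  obtains m where "c \<in> hom C Y X" "m \<in> hom C \<one> Y" "s = (c \<boxtimes> \<iota> Y) \<cdot> copy Y \<cdot> m"
proof (rule that)
  have "c \<in> hom C Y X" "s \<in> hom C \<one> (X \<otimes> Y)"
    using assms by (simp_all add: is_state_conditional_def is_conditional_def)
  then show "c \<in> hom C Y X" "marginal_snd C X Y s \<in> hom C \<one> Y"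
    using assms by simp_all
  show "s = (c \<boxtimes> \<iota> Y) \<cdot> copy Y \<cdot> marginal_snd C X Y s"
    using assms state_conditional_eq[of c Y X "marginal_snd C X Y s"]
    by (simp only: is_state_conditional_def is_conditional_def) simp
qed

text \<open>Copying a product is copying both factors followed by the middle interchange. Naturality
  moves the interchange past \<open>a\<close> and \<open>b\<close> onto powers of the unit, where
  terminality makes it invisible.\<close>

lemma deterministic_Tensor_state:
  assumes "deterministic C \<one> A a" "deterministic C \<one> B b"
  shows "deterministic C \<one> (A \<otimes> B) ((a \<boxtimes> b) \<cdot> inv (\<ell> \<one>))"
proof -
  have [simp]: "A \<in> Obj C" "B \<in> Obj C"
    using assms by (auto simp: deterministic_def)
  note [simp] = assms[unfolded deterministic_def hom_iff]
  have "copy (A \<otimes> B) \<cdot> (a \<boxtimes> b) \<cdot> copy \<one> =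
      middle_swap C A B \<cdot> ((a \<boxtimes> a) \<boxtimes> (b \<boxtimes> b)) \<cdot> (copy \<one> \<boxtimes> copy \<one>) \<cdot> copy \<one>"
    by (simp add: Copy_Tensor)
  also have "\<dots> = ((a \<boxtimes> b) \<boxtimes> (a \<boxtimes> b)) \<cdot> middle_swap C \<one> \<one> \<cdot> (copy \<one> \<boxtimes> copy \<one>) \<cdot> copy \<one>"
    by (subst Comp_cong_prefix[OF middle_swap_nat[of a \<one> A b \<one> B]]) simp_all
  also have "\<dots> = (((a \<boxtimes> b) \<cdot> copy \<one>) \<boxtimes> ((a \<boxtimes> b) \<cdot> copy \<one>)) \<cdot> copy \<one>"
    by (simp add: Copy_Unit_Tensor)
  finally show ?thesis
    by (simp add: deterministic_def Copy_Unit[symmetric])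
qed

lemma deterministic_tensor_states:
  assumes "\<And>i. i < k \<Longrightarrow> deterministic C \<one> (Y i) (y i)"
  shows "deterministic C \<one> (tensor_objs C Y k) (tensor_states C y k)"
  using assms
  by (induction k) (simp_all add: deterministic_Tensor_state, simp add: deterministic_def)

text \<open>Determinism lets \<open>s\<close> pass through the copy of \<open>A\<close>: one copy of
  \<open>s\<close> enters \<open>h\<close>, the other turns the marginal of \<open>\<phi>\<close>
  into that of \<open>\<phi> \<cdot> s\<close>.\<close>

lemma state_conditional_instantiate:
  assumes cond: "is_conditional C A X Y \<phi> h" and det: "deterministic C \<one> A s"
    and "A \<in> Obj C" "X \<in> Obj C" "Y \<in> Obj C"
  shows "is_state_conditional C X Y (\<phi> \<cdot> s) (h \<cdot> (s \<boxtimes> \<iota> Y) \<cdot> inv (\<ell> Y))"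
proof -
  note [simp] = assms(3-)
  define \<mu> where "\<mu> = marginal_snd C X Y \<phi>"
  have [simp]: "\<phi> \<in> Arr C" "Dom C \<phi> = A" "Cod C \<phi> = X \<otimes> Y" "h \<in> Arr C" "Dom C h = A \<otimes> Y" "Cod C h = X"
    and eq: "\<phi> = (h \<boxtimes> \<iota> Y) \<cdot> inv (\<alpha> A Y Y) \<cdot> (\<iota> A \<boxtimes> copy Y) \<cdot> (\<iota> A \<boxtimes> \<mu>) \<cdot> copy A"
    using cond by (simp_all only: is_conditional_def \<mu>_def hom_iff)
  have [simp]: "s \<in> Arr C" "Dom C s = \<one>" "Cod C s = A" "copy A \<cdot> s = (s \<boxtimes> s) \<cdot> copy \<one>"
    using det by (simp_all add: deterministic_def)
  have [simp]: "\<mu> \<in> Arr C" "Dom C \<mu> = A" "Cod C \<mu> = Y"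
    by (simp_all add: \<mu>_def)
  have "\<phi> \<cdot> s = (h \<boxtimes> \<iota> Y) \<cdot> inv (\<alpha> A Y Y) \<cdot> (\<iota> A \<boxtimes> copy Y) \<cdot> (s \<boxtimes> (\<mu> \<cdot> s)) \<cdot> copy \<one>"
    by (subst eq) simp
  also have "\<dots> = (h \<boxtimes> \<iota> Y) \<cdot> inv (\<alpha> A Y Y) \<cdot> (s \<boxtimes> (\<iota> Y \<boxtimes> \<iota> Y)) \<cdot>
      (\<iota> \<one> \<boxtimes> copy Y) \<cdot> (\<iota> \<one> \<boxtimes> (\<mu> \<cdot> s)) \<cdot> copy \<one>"
    by simp
  also have "\<dots> = ((h \<cdot> (s \<boxtimes> \<iota> Y)) \<boxtimes> \<iota> Y) \<cdot> inv (\<alpha> \<one> Y Y) \<cdot>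
      (\<iota> \<one> \<boxtimes> copy Y) \<cdot> (\<iota> \<one> \<boxtimes> (\<mu> \<cdot> s)) \<cdot> copy \<one>"
    by (subst Comp_cong_prefix[OF Assoc_inv_nat]) simp_all
  \<comment> \<open>The inverse unitor in the claimed conditional cancels against the unitor in
    \<open>is_state_conditional\<close>.\<close>
  finally show ?thesis
    using marginal_snd_Comp[of \<phi> X Y s]
    by (simp add: is_state_conditional_def is_conditional_def \<mu>_def)
qed

end

section \<open>Discarding after copying, and the rewiring of conditionals\<close>

context markov_category
begin

text \<open>Discarding the output of \<open>f\<close> discards its input, after which the counit law
  on \<open>B\<close> removes the copy. \<open>Runit_Tensor\<close> confines the unitor to
  \<open>B\<close>.\<close>

lemma Runit_discard_graph:
  assumes "A \<in> Obj C" "f \<in> hom C B D"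
  shows "\<rho> (A \<otimes> B) \<cdot> (\<iota> (A \<otimes> B) \<boxtimes> del D) \<cdot> inv (\<alpha> A B D) \<cdot> (\<iota> A \<boxtimes> ((\<iota> B \<boxtimes> f) \<cdot> copy B)) =
    \<iota> (A \<otimes> B)"
proof -
  have [simp]: "A \<in> Obj C" "B \<in> Obj C" "D \<in> Obj C"
    using assms by auto
  note [simp] = assms(2)[unfolded hom_iff]
  have "\<rho> (A \<otimes> B) \<cdot> (\<iota> (A \<otimes> B) \<boxtimes> del D) \<cdot> inv (\<alpha> A B D) \<cdot> (\<iota> A \<boxtimes> ((\<iota> B \<boxtimes> f) \<cdot> copy B)) =
      \<rho> (A \<otimes> B) \<cdot> (((\<iota> A \<boxtimes> \<iota> B) \<boxtimes> del D) \<cdot> inv (\<alpha> A B D)) \<cdot> (\<iota> A \<boxtimes> ((\<iota> B \<boxtimes> f) \<cdot> copy B))"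
    by simp
  also have "\<dots> = \<rho> (A \<otimes> B) \<cdot> (inv (\<alpha> A B \<one>) \<cdot> (\<iota> A \<boxtimes> (\<iota> B \<boxtimes> del D))) \<cdot>
      (\<iota> A \<boxtimes> ((\<iota> B \<boxtimes> f) \<cdot> copy B))"
    by (subst Assoc_inv_nat) simp_all
  also have "\<dots> = \<iota> A \<boxtimes> (\<rho> B \<cdot> (\<iota> B \<boxtimes> del B) \<cdot> copy B)"
    by (simp add: Runit_Tensor)
  also have "\<dots> = \<iota> (A \<otimes> B)"
    by (simp add: Copy_counit_right)
  finally show ?thesis .
qed

text \<open>Applied to an emission, this recovers the observation kernel once the hidden state is
  dropped.\<close>

lemma Lunit_del_graph:
  assumes "g \<in> hom C X Y"
  shows "\<ell> Y \<cdot> (del X \<boxtimes> \<iota> Y) \<cdot> (\<iota> X \<boxtimes> g) \<cdot> copy X = g"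
proof -
  have [simp]: "X \<in> Obj C" "Y \<in> Obj C"
    using assms by auto
  note [simp] = assms[unfolded hom_iff]
  have "\<ell> Y \<cdot> (del X \<boxtimes> \<iota> Y) \<cdot> (\<iota> X \<boxtimes> g) \<cdot> copy X =
      \<ell> Y \<cdot> (\<iota> \<one> \<boxtimes> g) \<cdot> (del X \<boxtimes> \<iota> X) \<cdot> copy X"
    by simp
  also have "\<dots> = g \<cdot> \<ell> X \<cdot> (del X \<boxtimes> \<iota> X) \<cdot> copy X"
    by (subst Comp_cong_prefix[OF Lunit_nat]) simp_all
  also have "\<dots> = g"
    by (simp add: Copy_counit_left)
  finally show ?thesis .
qed

text \<open>Drawing \<open>\<phi>\<close> with its conditional, cocommutativity of the copy on \<open>Y\<close> and the hexagon reduce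
  the rewiring to the middle interchange in the copy on \<open>A \<otimes> Y\<close>.\<close>

lemma graph_conditional:
  assumes cond: "is_conditional C A X Y \<phi> h" and [simp]: "A \<in> Obj C" "X \<in> Obj C" "Y \<in> Obj C"
  shows "inv (\<alpha> A Y X) \<cdot> (\<iota> A \<boxtimes> (\<sigma> X Y \<cdot> \<phi>)) \<cdot> copy A =
    (\<iota> (A \<otimes> Y) \<boxtimes> h) \<cdot> copy (A \<otimes> Y) \<cdot> (\<iota> A \<boxtimes> marginal_snd C X Y \<phi>) \<cdot> copy A"
proof -
  define \<mu> where "\<mu> = marginal_snd C X Y \<phi>"
  have [simp]: "\<phi> \<in> Arr C" "Dom C \<phi> = A" "Cod C \<phi> = X \<otimes> Y" "h \<in> Arr C" "Dom C h = A \<otimes> Y" "Cod C h = X"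
    and eq: "\<phi> = (h \<boxtimes> \<iota> Y) \<cdot> inv (\<alpha> A Y Y) \<cdot> (\<iota> A \<boxtimes> copy Y) \<cdot> (\<iota> A \<boxtimes> \<mu>) \<cdot> copy A"
    using cond by (simp_all only: is_conditional_def \<mu>_def hom_iff)
  have [simp]: "\<mu> \<in> Arr C" "Dom C \<mu> = A" "Cod C \<mu> = Y"
    by (simp_all add: \<mu>_def)
  \<comment> \<open>The inner part of \<open>middle_swap C A Y\<close>.\<close>
  define J where "J = \<alpha> Y A Y \<cdot> (\<sigma> A Y \<boxtimes> \<iota> Y) \<cdot> inv (\<alpha> A Y Y)"
  have [simp]: "J \<in> Arr C" "Dom C J = A \<otimes> (Y \<otimes> Y)" "Cod C J = Y \<otimes> (A \<otimes> Y)"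
    by (simp_all add: J_def)
  \<comment> \<open>Cocommutativity supplies the extra \<open>\<sigma> Y Y\<close>, which brings the
    composite into the shape of \<open>Sym_Tensor_left\<close>.\<close>
  have "\<sigma> X Y \<cdot> \<phi> = \<sigma> X Y \<cdot> (h \<boxtimes> \<iota> Y) \<cdot> inv (\<alpha> A Y Y) \<cdot>
      (\<iota> A \<boxtimes> \<sigma> Y Y) \<cdot> (\<iota> A \<boxtimes> (copy Y \<cdot> \<mu>)) \<cdot> copy A"
    by (subst eq) simp
  also have "\<dots> = (\<iota> Y \<boxtimes> h) \<cdot> (\<sigma> (A \<otimes> Y) Y \<cdot> inv (\<alpha> A Y Y) \<cdot> (\<iota> A \<boxtimes> \<sigma> Y Y)) \<cdot>
      (\<iota> A \<boxtimes> (copy Y \<cdot> \<mu>)) \<cdot> copy A"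
    by (subst Comp_cong_prefix[OF Sym_nat]) simp_all
  also have "\<dots> = (\<iota> Y \<boxtimes> h) \<cdot> J \<cdot> (\<iota> A \<boxtimes> (copy Y \<cdot> \<mu>)) \<cdot> copy A"
    by (simp only: Sym_Tensor_left assms(2-) J_def)
  finally have sym: "\<sigma> X Y \<cdot> \<phi> = (\<iota> Y \<boxtimes> h) \<cdot> J \<cdot> (\<iota> A \<boxtimes> (copy Y \<cdot> \<mu>)) \<cdot> copy A" .
  have "inv (\<alpha> A Y X) \<cdot> (\<iota> A \<boxtimes> (\<sigma> X Y \<cdot> \<phi>)) \<cdot> copy A =
      inv (\<alpha> A Y X) \<cdot> (\<iota> A \<boxtimes> (\<iota> Y \<boxtimes> h)) \<cdot> (\<iota> A \<boxtimes> J) \<cdot>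
      (\<iota> A \<boxtimes> (\<iota> A \<boxtimes> (copy Y \<cdot> \<mu>))) \<cdot> (\<iota> A \<boxtimes> copy A) \<cdot> copy A"
    by (simp add: sym)
  \<comment> \<open>Coassociativity pairs the first two copies of \<open>A\<close>, as the copy on
    \<open>A \<otimes> Y\<close> requires.\<close>
  also have "\<dots> = inv (\<alpha> A Y X) \<cdot> (\<iota> A \<boxtimes> (\<iota> Y \<boxtimes> h)) \<cdot> (\<iota> A \<boxtimes> J) \<cdot>
      (\<iota> A \<boxtimes> (\<iota> A \<boxtimes> (copy Y \<cdot> \<mu>))) \<cdot> \<alpha> A A A \<cdot> (copy A \<boxtimes> \<iota> A) \<cdot> copy A"
    by (simp only: Copy_coassoc assms(2-))
  also have "\<dots> = ((\<iota> A \<boxtimes> \<iota> Y) \<boxtimes> h) \<cdot> inv (\<alpha> A Y (A \<otimes> Y)) \<cdot> (\<iota> A \<boxtimes> J) \<cdot>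
      (\<iota> A \<boxtimes> (\<iota> A \<boxtimes> (copy Y \<cdot> \<mu>))) \<cdot> \<alpha> A A A \<cdot> (copy A \<boxtimes> \<iota> A) \<cdot> copy A"
    by (subst Comp_cong_prefix[OF Assoc_inv_nat]) (simp_all del: interchange interchange_prefix)
  also have "\<dots> = ((\<iota> A \<boxtimes> \<iota> Y) \<boxtimes> h) \<cdot> inv (\<alpha> A Y (A \<otimes> Y)) \<cdot> (\<iota> A \<boxtimes> J) \<cdot>
      \<alpha> A A (Y \<otimes> Y) \<cdot> ((\<iota> A \<boxtimes> \<iota> A) \<boxtimes> (copy Y \<cdot> \<mu>)) \<cdot> (copy A \<boxtimes> \<iota> A) \<cdot> copy A"
    by (subst Comp_cong_prefix[OF Assoc_nat]) simp_all
  also have "\<dots> = (\<iota> (A \<otimes> Y) \<boxtimes> h) \<cdot> copy (A \<otimes> Y) \<cdot> (\<iota> A \<boxtimes> \<mu>) \<cdot> copy A"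
    by (simp add: Copy_Tensor middle_swap_def J_def)
  finally show ?thesis
    by (simp only: \<mu>_def)
qed

end

section \<open>Hidden Markov models and their truncation to an earlier final time\<close>

locale hidden_markov = markov_category +
  fixes X Y :: "nat \<Rightarrow> 'a" and f g :: "nat \<Rightarrow> 'b" and n :: nat
  assumes X_Obj: "t \<le> n \<Longrightarrow> X t \<in> Obj C" and Y_Obj: "t \<le> n \<Longrightarrow> Y t \<in> Obj C"
    and f_hom: "t \<le> n \<Longrightarrow> f t \<in> hom C (prev_obj C X t) (X t)"
    and g_hom: "t \<le> n \<Longrightarrow> g t \<in> hom C (X t) (Y t)"
begin

declare X_Obj [simp] Y_Obj [simp]

lemma f_simps [simp]:
  "t \<le> n \<Longrightarrow> f t \<in> Arr C" "t \<le> n \<Longrightarrow> Dom C (f t) = prev_obj C X t" "t \<le> n \<Longrightarrow> Cod C (f t) = X t"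
  and g_simps [simp]:
  "t \<le> n \<Longrightarrow> g t \<in> Arr C" "t \<le> n \<Longrightarrow> Dom C (g t) = X t" "t \<le> n \<Longrightarrow> Cod C (g t) = Y t"
  using f_hom g_hom by simp_all

lemma prev_obj_simps [simp]: "prev_obj C X 0 = \<one>" "prev_obj C X (Suc t) = X t"
  by (simp_all add: prev_obj_def)

abbreviation emission :: "nat \<Rightarrow> 'b" where
  "emission t \<equiv> (\<iota> (X t) \<boxtimes> g t) \<cdot> copy (X t)"

abbreviation XY :: "nat \<Rightarrow> 'a" where
  "XY t \<equiv> X t \<otimes> Y t"

abbreviation (input) HMM :: "nat \<Rightarrow> 'b" where
  "HMM t \<equiv> hidden_markov_model C X f g t"

lemma tensor_XY_in_Obj [simp]:
  assumes "k \<le> Suc n"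
  shows "tensor_objs C X k \<in> Obj C" "tensor_objs C Y k \<in> Obj C" "tensor_objs C XY k \<in> Obj C"
  using assms by simp_all

lemma tensor_emission_simps [simp]:
  assumes "k \<le> Suc n"
  shows "tensor_arrs C emission k \<in> Arr C" "Dom C (tensor_arrs C emission k) = tensor_objs C X k"
    "Cod C (tensor_arrs C emission k) = tensor_objs C XY k"
  using assms tensor_arrs_hom[of k emission X XY] by simp_all

lemma tensor_observation_simps [simp]:
  assumes "k \<le> Suc n"
  shows "tensor_arrs C g k \<in> Arr C" "Dom C (tensor_arrs C g k) = tensor_objs C X k"
    "Cod C (tensor_arrs C g k) = tensor_objs C Y k"
  using assms tensor_arrs_hom[of k g X Y] by simp_all

lemma hidden_state_simps [simp]:
  assumes "t \<le> n"
  shows "hidden_state C X f t \<in> Arr C" "Dom C (hidden_state C X f t) = \<one>"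
    "Cod C (hidden_state C X f t) = tensor_objs C X t \<otimes> X t"
proof -
  have "hidden_state C X f t \<in> hom C \<one> (tensor_objs C X t \<otimes> X t)"
    using assms by (induction t) simp_all
  then show "hidden_state C X f t \<in> Arr C" "Dom C (hidden_state C X f t) = \<one>"
    "Cod C (hidden_state C X f t) = tensor_objs C X t \<otimes> X t"
    by simp_all
qed

lemma HMM_simps [simp]:
  assumes "t \<le> n"
  shows "HMM t \<in> Arr C" "Dom C (HMM t) = \<one>" "Cod C (HMM t) = tensor_objs C XY t \<otimes> X t \<otimes> Y t"
  using assms by (simp_all add: hidden_markov_model_def)

text \<open>Discarding the last pair discards the emission and then the transition into
  \<open>X (Suc t)\<close>. The copy of \<open>X t\<close> made for that transition disappears by
  the counit law.\<close>

lemma discard_HMM_Suc: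
  assumes "Suc t \<le> n"
  shows "\<rho> (tensor_objs C XY (Suc t)) \<cdot> (\<iota> (tensor_objs C XY (Suc t)) \<boxtimes> del (XY (Suc t))) \<cdot>
    HMM (Suc t) = HMM t"
proof -
  let ?A = "tensor_objs C X t" and ?B = "X t" and ?D = "X (Suc t)"
    and ?T = "tensor_objs C XY (Suc t)" and ?E = "tensor_arrs C emission (Suc t)"
    and ?S = "(\<iota> (X t) \<boxtimes> f (Suc t)) \<cdot> copy (X t)"
  have [simp]: "Suc t \<le> n" "t \<le> n" "t \<le> Suc n"
    using assms by simp_all
  have [simp]: "?A \<in> Obj C" "?T \<in> Obj C" "?E \<in> Arr C" "Dom C ?E = ?A \<otimes> ?B" "Cod C ?E = ?T"
    using assms tensor_XY_in_Obj[of "Suc t"] tensor_emission_simps[of "Suc t"] by simp_all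
  have HMM_t: "HMM t = ?E \<cdot> hidden_state C X f t"
    by (simp only: hidden_markov_model_def)
  have HMM_Suc: "HMM (Suc t) = (?E \<boxtimes> emission (Suc t)) \<cdot> inv (\<alpha> ?A ?B ?D) \<cdot> (\<iota> ?A \<boxtimes> ?S) \<cdot>
      hidden_state C X f t"
    by (simp only: hidden_markov_model_def tensor_arrs.simps(2)[of _ _ "Suc t"] hidden_state.simps)
  have "\<rho> ?T \<cdot> (\<iota> ?T \<boxtimes> del (XY (Suc t))) \<cdot> HMM (Suc t) = \<rho> ?T \<cdot> (?E \<boxtimes> \<iota> \<one>) \<cdot>
      (\<iota> (?A \<otimes> ?B) \<boxtimes> del ?D) \<cdot> inv (\<alpha> ?A ?B ?D) \<cdot> (\<iota> ?A \<boxtimes> ?S) \<cdot> hidden_state C X f t"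
    unfolding HMM_Suc by (simp del: tensor_objs.simps tensor_arrs.simps)
  also have "\<dots> = ?E \<cdot> (\<rho> (?A \<otimes> ?B) \<cdot>
      (\<iota> (?A \<otimes> ?B) \<boxtimes> del ?D) \<cdot> inv (\<alpha> ?A ?B ?D) \<cdot> (\<iota> ?A \<boxtimes> ?S)) \<cdot> hidden_state C X f t"
    by (subst Comp_cong_prefix[OF Runit_nat]) (simp_all del: tensor_objs.simps tensor_arrs.simps)
  also have "\<dots> = HMM t"
    by (subst Runit_discard_graph) (simp_all add: HMM_t del: tensor_objs.simps tensor_arrs.simps)
  finally show ?thesis .
qed

lemma discard_last_simps [simp]:
  assumes "k + j \<le> Suc n"
  shows "discard_last C XY k j \<in> Arr C" "Dom C (discard_last C XY k j) = tensor_objs C XY (k + j)"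
    "Cod C (discard_last C XY k j) = tensor_objs C XY k"
proof -
  have "discard_last C XY k j \<in> hom C (tensor_objs C XY (k + j)) (tensor_objs C XY k)"
    using assms by (induction j) simp_all
  then show "discard_last C XY k j \<in> Arr C" "Dom C (discard_last C XY k j) = tensor_objs C XY (k + j)"
    "Cod C (discard_last C XY k j) = tensor_objs C XY k"
    by simp_all
qed

lemma discard_last_HMM: "t + j \<le> n \<Longrightarrow> discard_last C XY (Suc t) j \<cdot> HMM (t + j) = HMM t"
proof (induction j)
  case 0
  then show ?case
    by simp
next
  case (Suc j)
  have [simp]: "tensor_objs C XY (Suc t + j) \<in> Obj C"
    using Suc.prems by (intro tensor_XY_in_Obj) simp
  \<comment> \<open>The last factor of the model has index \<open>Suc t + j\<close> in
    \<open>discard_last\<close> and \<open>t + Suc j\<close> as a time.\<close>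
  have cod: "Cod C (HMM (t + Suc j)) = tensor_objs C XY (Suc t + j) \<otimes> XY (Suc t + j)"
    using Suc.prems HMM_simps(3)[of "t + Suc j"] by simp
  have "discard_last C XY (Suc t) (Suc j) \<cdot> HMM (t + Suc j) = discard_last C XY (Suc t) j \<cdot>
      \<rho> (tensor_objs C XY (Suc t + j)) \<cdot>
      (\<iota> (tensor_objs C XY (Suc t + j)) \<boxtimes> del (XY (Suc t + j))) \<cdot> HMM (t + Suc j)"
    using Suc.prems HMM_simps(1)[of "t + Suc j"] cod by (simp del: tensor_objs.simps)
  also have "\<dots> = discard_last C XY (Suc t) j \<cdot> HMM (t + j)"
    using discard_HMM_Suc[of "t + j"] Suc.prems by (simp del: tensor_objs.simps)
  finally show ?case
    using Suc by simp
qed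

section \<open>Prediction and filter marginals\<close>

text \<open>The joint state of \<open>Y\<^sub>0, \<dots>, Y\<^bsub>t-1\<^esub>, X\<^sub>t\<close>, that is, the prediction step of the filter.\<close>

definition prediction :: "nat \<Rightarrow> 'b" where
  "prediction t = (tensor_arrs C g t \<boxtimes> \<iota> (X t)) \<cdot> hidden_state C X f t"

text \<open>The inverse unitor is written as a copy of the unit, so that the initial state already
  has the graph form demanded by \<open>predicts\<close>.\<close>

lemma prediction_0: "prediction 0 = (\<iota> \<one> \<boxtimes> f 0) \<cdot> copy \<one>"
  by (simp add: prediction_def Lunit_inv_nat Copy_Unit)

text \<open>The update step: the future truncates the model, each earlier emission becomes its
  observation kernel, and only the hidden state at time \<open>t\<close> is kept next to its
  observation.\<close>

lemma filter_marginal_prediction: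
  assumes "t \<le> n"
  shows "filter_marginal C X Y n (HMM n) t =
    inv (\<alpha> (tensor_objs C Y t) (Y t) (X t)) \<cdot>
    (\<iota> (tensor_objs C Y t) \<boxtimes> ((g t \<boxtimes> \<iota> (X t)) \<cdot> copy (X t))) \<cdot> prediction t"
proof -
  let ?M = "tensor_arrs C (\<lambda>s. \<ell> (Y s) \<cdot> (del (X s) \<boxtimes> \<iota> (Y s))) t"
  have le: "s \<le> n" if "s < t" for s
    using assms that by simp
  have [simp]: "t \<le> n" "t \<le> Suc n"
    using assms by simp_all
  have M [simp]: "?M \<in> Arr C" "Dom C ?M = tensor_objs C XY t" "Cod C ?M = tensor_objs C Y t"
    using tensor_arrs_hom[of t "\<lambda>s. \<ell> (Y s) \<cdot> (del (X s) \<boxtimes> \<iota> (Y s))" XY Y] by (simp_all add: le)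
  have "?M \<cdot> tensor_arrs C emission t =
      tensor_arrs C (\<lambda>s. (\<ell> (Y s) \<cdot> (del (X s) \<boxtimes> \<iota> (Y s))) \<cdot> emission s) t"
    by (rule tensor_arrs_Comp[where A = X and B = XY and D = Y]) (simp_all add: le)
  also have "\<dots> = tensor_arrs C g t"
  proof (rule tensor_arrs_cong)
    fix s assume "s < t"
    then show "(\<ell> (Y s) \<cdot> (del (X s) \<boxtimes> \<iota> (Y s))) \<cdot> emission s = g s"
      using Lunit_del_graph[of "g s" "X s" "Y s"] by (simp add: le)
  qed
  finally have observe: "?M \<cdot> tensor_arrs C emission t = tensor_arrs C g t" .
  \<comment> \<open>After naturality has moved the symmetry onto the copy, cocommutativity absorbs
    it.\<close>
  have sym: "\<sigma> (X t) (Y t) \<cdot> emission t = (g t \<boxtimes> \<iota> (X t)) \<cdot> copy (X t)"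
    by (simp add: Comp_cong_prefix[OF Sym_nat])
  have "filter_marginal C X Y n (HMM n) t =
      inv (\<alpha> (tensor_objs C Y t) (Y t) (X t)) \<cdot> (?M \<boxtimes> \<sigma> (X t) (Y t)) \<cdot> HMM t"
    using discard_last_HMM[of t "n - t"] assms by (simp add: filter_marginal_def)
  also have "\<dots> = inv (\<alpha> (tensor_objs C Y t) (Y t) (X t)) \<cdot>
      ((?M \<cdot> tensor_arrs C emission t) \<boxtimes> (\<sigma> (X t) (Y t) \<cdot> emission t)) \<cdot> hidden_state C X f t"
    by (simp add: hidden_markov_model_def)
  also have "\<dots> = inv (\<alpha> (tensor_objs C Y t) (Y t) (X t)) \<cdot>
      (tensor_arrs C g t \<boxtimes> ((g t \<boxtimes> \<iota> (X t)) \<cdot> copy (X t))) \<cdot> hidden_state C X f t"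
    by (simp only: observe sym)
  also have "\<dots> = inv (\<alpha> (tensor_objs C Y t) (Y t) (X t)) \<cdot>
      (\<iota> (tensor_objs C Y t) \<boxtimes> ((g t \<boxtimes> \<iota> (X t)) \<cdot> copy (X t))) \<cdot> prediction t"
    by (simp add: prediction_def)
  finally show ?thesis .
qed

text \<open>The Markov property: the transition acts on the copy of \<open>X t\<close> left over
  from the observation, and on nothing earlier.\<close>

lemma prediction_Suc:
  assumes "Suc t \<le> n"
  shows "prediction (Suc t) =
    (\<iota> (tensor_objs C Y (Suc t)) \<boxtimes> f (Suc t)) \<cdot> filter_marginal C X Y n (HMM n) t"
proof -
  have [simp]: "Suc t \<le> n" "t \<le> n" "t \<le> Suc n"
    using assms by simp_all
  let ?G = "tensor_arrs C g t"
  have "prediction (Suc t) = ((?G \<boxtimes> g t) \<boxtimes> \<iota> (X (Suc t))) \<cdot>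
      inv (\<alpha> (tensor_objs C X t) (X t) (X (Suc t))) \<cdot>
      (\<iota> (tensor_objs C X t) \<boxtimes> ((\<iota> (X t) \<boxtimes> f (Suc t)) \<cdot> copy (X t))) \<cdot> hidden_state C X f t"
    by (simp add: prediction_def)
  also have "\<dots> = inv (\<alpha> (tensor_objs C Y t) (Y t) (X (Suc t))) \<cdot> (?G \<boxtimes> (g t \<boxtimes> \<iota> (X (Suc t)))) \<cdot>
      (\<iota> (tensor_objs C X t) \<boxtimes> ((\<iota> (X t) \<boxtimes> f (Suc t)) \<cdot> copy (X t))) \<cdot> hidden_state C X f t"
    by (subst Comp_cong_prefix[OF Assoc_inv_nat]) simp_all
  also have "\<dots> = inv (\<alpha> (tensor_objs C Y t) (Y t) (X (Suc t))) \<cdot>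
      (\<iota> (tensor_objs C Y t) \<boxtimes> (\<iota> (Y t) \<boxtimes> f (Suc t))) \<cdot>
      (\<iota> (tensor_objs C Y t) \<boxtimes> ((g t \<boxtimes> \<iota> (X t)) \<cdot> copy (X t))) \<cdot> prediction t"
    by (simp add: prediction_def)
  also have "\<dots> = ((\<iota> (tensor_objs C Y t) \<boxtimes> \<iota> (Y t)) \<boxtimes> f (Suc t)) \<cdot>
      filter_marginal C X Y n (HMM n) t"
    by (subst Comp_cong_prefix[OF Assoc_inv_nat])
      (simp_all add: filter_marginal_prediction prediction_def)
  finally show ?thesis
    by simp
qed

section \<open>The recursion for versions of the filter\<close>

text \<open>The only property of the filter of the previous step that the recursion uses. Every version of
  the Bayes filter has it, so the prescribed and the chosen versions need no separate treatment.\<close>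

definition predicts :: "nat \<Rightarrow> 'b \<Rightarrow> bool" where
  "predicts t b \<longleftrightarrow> b \<in> hom C (tensor_objs C Y t) (prev_obj C X t) \<and>
    (\<exists>m \<in> hom C \<one> (tensor_objs C Y t).
      prediction t = (\<iota> (tensor_objs C Y t) \<boxtimes> (f t \<cdot> b)) \<cdot> copy (tensor_objs C Y t) \<cdot> m)"

lemma predicts_0: "predicts 0 (\<iota> \<one>)"
  by (auto simp: predicts_def prediction_0 intro!: bexI[of _ "\<iota> \<one>"])

text \<open>A filter version displays the filter marginal as its graph over some \<open>m\<close>.
  The transition acts on the hidden factor alone, so \<open>b\<close> becomes
  \<open>f (Suc t) \<cdot> b\<close> over the same \<open>m\<close>.\<close>

lemma predicts_Suc:
  assumes "is_bayes_filter C X Y n (HMM n) t b" "Suc t \<le> n"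
  shows "predicts (Suc t) b"
proof -
  let ?A = "tensor_objs C Y (Suc t)"
  have [simp]: "Suc t \<le> n" "t \<le> n" "t \<le> Suc n"
    using assms(2) by simp_all
  have [simp]: "?A \<in> Obj C"
    using assms(2) by (intro tensor_XY_in_Obj) simp
  obtain m where b: "b \<in> hom C ?A (X t)" and m: "m \<in> hom C \<one> ?A"
    and eq: "\<sigma> ?A (X t) \<cdot> filter_marginal C X Y n (HMM n) t = (b \<boxtimes> \<iota> ?A) \<cdot> copy ?A \<cdot> m"
    using state_conditionalE[OF assms(1)[unfolded is_bayes_filter_def]] \<open>?A \<in> Obj C\<close> \<open>t \<le> n\<close> X_Obj
    by blast
  have fm: "filter_marginal C X Y n (HMM n) t \<in> hom C \<one> (?A \<otimes> X t)"
    by (simp add: filter_marginal_prediction prediction_def)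
  have "filter_marginal C X Y n (HMM n) t = \<sigma> (X t) ?A \<cdot> \<sigma> ?A (X t) \<cdot> filter_marginal C X Y n (HMM n) t"
    using fm by (simp del: tensor_objs.simps)
  also have "\<dots> = (\<iota> ?A \<boxtimes> b) \<cdot> copy ?A \<cdot> m"
    unfolding eq using b m
    by (subst Comp_cong_prefix[OF Sym_nat]) (simp_all del: tensor_objs.simps)
  finally have "prediction (Suc t) = (\<iota> ?A \<boxtimes> (f (Suc t) \<cdot> b)) \<cdot> copy ?A \<cdot> m"
    using b m by (simp add: prediction_Suc del: tensor_objs.simps)
  then show ?thesis
    using b m by (auto simp: predicts_def simp del: tensor_objs.simps)
qed

text \<open>The display of the prediction over \<open>m\<close> makes the filter marginal the graph
  of \<open>\<phi>\<close> with its outputs exchanged, and \<open>graph_conditional\<close> turns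
  this into the graph of \<open>h\<close>. Left bracketing makes the domain of \<open>h\<close>
  equal to \<open>tensor_objs C Y (Suc t)\<close> on the nose.\<close>

lemma bayes_filter_step:
  assumes "predicts t b" and "t \<le> n"
    and cond: "is_conditional C (tensor_objs C Y t) (X t) (Y t)
      ((\<iota> (X t) \<boxtimes> g t) \<cdot> copy (X t) \<cdot> f t \<cdot> b) h"
  shows "is_bayes_filter C X Y n (HMM n) t h"
proof -
  let ?A = "tensor_objs C Y t"
  define \<phi> where "\<phi> = (\<iota> (X t) \<boxtimes> g t) \<cdot> copy (X t) \<cdot> f t \<cdot> b"
  define \<mu> where "\<mu> = marginal_snd C (X t) (Y t) \<phi>"
  have [simp]: "t \<le> n" "t \<le> Suc n"
    using assms(2) by simp_all
  have cond': "is_conditional C ?A (X t) (Y t) \<phi> h"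
    using cond by (simp only: \<phi>_def)
  obtain m where [simp]: "b \<in> Arr C" "Dom C b = ?A" "Cod C b = prev_obj C X t"
    "m \<in> Arr C" "Dom C m = \<one>" "Cod C m = ?A"
    and pred: "prediction t = (\<iota> ?A \<boxtimes> (f t \<cdot> b)) \<cdot> copy ?A \<cdot> m"
    using assms(1) unfolding predicts_def by auto
  have [simp]: "\<phi> \<in> Arr C" "Dom C \<phi> = ?A" "Cod C \<phi> = X t \<otimes> Y t"
    by (simp_all add: \<phi>_def)
  have [simp]: "\<mu> \<in> Arr C" "Dom C \<mu> = ?A" "Cod C \<mu> = Y t"
    by (simp_all add: \<mu>_def)
  have [simp]: "h \<in> Arr C" "Dom C h = ?A \<otimes> Y t" "Cod C h = X t"
    using cond' by (simp_all only: is_conditional_def hom_iff)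
  have sym: "\<sigma> (X t) (Y t) \<cdot> \<phi> = (g t \<boxtimes> \<iota> (X t)) \<cdot> copy (X t) \<cdot> f t \<cdot> b"
    unfolding \<phi>_def by (subst Comp_cong_prefix[OF Sym_nat]) simp_all
  have "filter_marginal C X Y n (HMM n) t =
      (inv (\<alpha> ?A (Y t) (X t)) \<cdot> (\<iota> ?A \<boxtimes> (\<sigma> (X t) (Y t) \<cdot> \<phi>)) \<cdot> copy ?A) \<cdot> m"
    by (simp add: filter_marginal_prediction pred sym)
  also have "\<dots> = (\<iota> (?A \<otimes> Y t) \<boxtimes> h) \<cdot> copy (?A \<otimes> Y t) \<cdot> (\<iota> ?A \<boxtimes> \<mu>) \<cdot> copy ?A \<cdot> m"
    by (subst graph_conditional[OF cond']) (simp_all add: \<mu>_def[symmetric])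
  finally have "\<sigma> (?A \<otimes> Y t) (X t) \<cdot> filter_marginal C X Y n (HMM n) t =
      (h \<boxtimes> \<iota> (?A \<otimes> Y t)) \<cdot> copy (?A \<otimes> Y t) \<cdot> (\<iota> ?A \<boxtimes> \<mu>) \<cdot> copy ?A \<cdot> m"
    by (simp only:) (subst Comp_cong_prefix[OF Sym_nat], simp_all)
  \<comment> \<open>The marginal on the observations up to \<open>t\<close> extends \<open>m\<close>
    by the predicted observation \<open>\<mu>\<close>.\<close>
  then show ?thesis
    using state_conditional_graph[of h "?A \<otimes> Y t" "X t" "(\<iota> ?A \<boxtimes> \<mu>) \<cdot> copy ?A \<cdot> m"]
    by (simp only: is_bayes_filter_def tensor_objs.simps) simp
qed

text \<open>Shifted by one, so that the value at \<open>0\<close> is the filter before time \<open>0\<close>; the first \<open>k\<close> filters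
  are prescribed.\<close>

primrec filter_seq :: "nat \<Rightarrow> (nat \<Rightarrow> 'b) \<Rightarrow> nat \<Rightarrow> 'b" where
  "filter_seq k BF0 0 = \<iota> \<one>"
| "filter_seq k BF0 (Suc t) = (if t < k then BF0 t else
    SOME h. is_conditional C (tensor_objs C Y t) (X t) (Y t)
      ((\<iota> (X t) \<boxtimes> g t) \<cdot> copy (X t) \<cdot> f t \<cdot> filter_seq k BF0 t) h)"

text \<open>From time \<open>k\<close> on the choice operator has a witness: \<open>predicts\<close>
  types the previous entry, so the arrow to be conditioned has a conditional.\<close>

lemma filter_seq_conditional:
  assumes "has_conditionals C" "predicts t (filter_seq k BF0 t)" "t \<le> n" "k \<le> t"
  shows "is_conditional C (tensor_objs C Y t) (X t) (Y t)
    ((\<iota> (X t) \<boxtimes> g t) \<cdot> copy (X t) \<cdot> f t \<cdot> filter_seq k BF0 t) (filter_seq k BF0 (Suc t))"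
proof -
  have "\<exists>h. is_conditional C (tensor_objs C Y t) (X t) (Y t)
      ((\<iota> (X t) \<boxtimes> g t) \<cdot> copy (X t) \<cdot> f t \<cdot> filter_seq k BF0 t) h"
    using assms unfolding has_conditionals_def by (simp add: predicts_def)
  then show ?thesis
    using assms(4) by (simp add: someI_ex)
qed

text \<open>The two claims feed each other: \<open>predicts\<close> at \<open>t\<close> validates a
  chosen filter at \<open>t\<close>, and any filter at \<open>t\<close>, chosen or prescribed,
  yields \<open>predicts\<close> at \<open>Suc t\<close>.\<close>

lemma filter_seq_bayes:
  assumes "has_conditionals C" "\<And>t. t < k \<Longrightarrow> t \<le> n \<Longrightarrow> is_bayes_filter C X Y n (HMM n) t (BF0 t)"
    "t \<le> n"
  shows "predicts t (filter_seq k BF0 t) \<and> is_bayes_filter C X Y n (HMM n) t (filter_seq k BF0 (Suc t))"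
  using assms(3)
proof (induction t)
  case 0
  then show ?case
    using assms(2) bayes_filter_step[of 0] filter_seq_conditional[OF assms(1), of 0 k BF0] predicts_0
    by (cases "k = 0") simp_all
next
  case (Suc t)
  then have "predicts (Suc t) (filter_seq k BF0 (Suc t))"
    using predicts_Suc by simp
  then show ?case
    using Suc.prems assms(2) bayes_filter_step[of "Suc t"]
      filter_seq_conditional[OF assms(1), of "Suc t" k BF0]
    by (cases "Suc t < k") (simp_all del: filter_seq.simps(2) add: filter_seq.simps(2)[of _ _ "Suc t"])
qed

end

text \<open>Filters are determined only almost surely, so the recursion is a statement about
  choices: arbitrary versions may be prescribed before time \<open>k\<close>, and suitable ones
  exist from \<open>k\<close> on. One \<open>BF\<close> and one \<open>cnd\<close> serve all
  \<open>y\<close>. The conditional sees only the observations before \<open>t\<close>, so it cannot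
  be adapted to \<open>y t\<close>.\<close>

theorem proposition4p7:
  fixes C :: "('o, 'm, 'z) markov_structure_scheme" (structure)
    and X Y :: "nat \<Rightarrow> 'o" and f g :: "nat \<Rightarrow> 'm" and p :: 'm and n :: nat
  assumes "markov_category C" and "has_conditionals C"
    and "\<And>t. t \<le> n \<Longrightarrow> X t \<in> Obj C" and "\<And>t. t \<le> n \<Longrightarrow> Y t \<in> Obj C"
    and "\<And>t. t \<le> n \<Longrightarrow> f t \<in> hom C (prev_obj C X t) (X t)"
    and "\<And>t. t \<le> n \<Longrightarrow> g t \<in> hom C (X t) (Y t)"
    and "p = hidden_markov_model C X f g n"
  shows "\<forall>k BF0. (\<forall>t<k. t \<le> n \<longrightarrow> is_bayes_filter C X Y n p t (BF0 t)) \<longrightarrow>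
    (\<exists>BF :: nat \<Rightarrow> 'm. \<exists>cnd :: nat \<Rightarrow> 'm list \<Rightarrow> 'm.
      (\<forall>t<k. BF t = BF0 t) \<and>
      (\<forall>t\<le>n. is_bayes_filter C X Y n p t (BF t)) \<and>
      (\<forall>y. (\<forall>t\<le>n. deterministic C \<one> (Y t) (y t)) \<longrightarrow>
        (\<forall>t. k \<le> t \<and> t \<le> n \<longrightarrow>
          is_state_conditional C (X t) (Y t)
            ((\<iota> (X t) \<boxtimes> g t) \<cdot> copy (X t) \<cdot> f t \<cdot> prev_IBF C BF y t)
            (cnd t (map y [0..<t])) \<and>
          IBF C BF y t = cnd t (map y [0..<t]) \<cdot> y t)))"
proof (intro allI impI)
  fix k and BF0 :: "nat \<Rightarrow> 'm"
  assume BF0: "\<forall>t<k. t \<le> n \<longrightarrow> is_bayes_filter C X Y n p t (BF0 t)"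
  interpret hidden_markov C X Y f g n
    using assms(1,3-6) by (simp add: hidden_markov_def hidden_markov_axioms_def)
  let ?P = "filter_seq k BF0"
  define BF where "BF = (\<lambda>t. ?P (Suc t))"
  \<comment> \<open>The list fills the first \<open>t\<close> inputs of \<open>BF t\<close>, and the
    inverse unitor leaves \<open>Y t\<close> as the only open input.\<close>
  define cnd where "cnd = (\<lambda>t ys. BF t \<cdot> (tensor_states C ((!) ys) t \<boxtimes> \<iota> (Y t)) \<cdot> inv (\<ell> (Y t)))"
  have P: "predicts t (?P t) \<and> is_bayes_filter C X Y n p t (BF t)" if "t \<le> n" for t
    using filter_seq_bayes[OF assms(2), of k BF0 t] BF0 that by (simp only: BF_def assms(7))
  have "is_state_conditional C (X t) (Y t)
      ((\<iota> (X t) \<boxtimes> g t) \<cdot> copy (X t) \<cdot> f t \<cdot> prev_IBF C BF y t) (cnd t (map y [0..<t])) \<and>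
    IBF C BF y t = cnd t (map y [0..<t]) \<cdot> y t"
    if y: "\<forall>t\<le>n. deterministic C \<one> (Y t) (y t)" and t: "k \<le> t" "t \<le> n" for y t
  proof -
    define s where "s = tensor_states C y t"
    have det: "deterministic C \<one> (tensor_objs C Y t) s"
      unfolding s_def using y t by (intro deterministic_tensor_states) simp
    have [simp]: "t \<le> n" "X t \<in> Obj C" "Y t \<in> Obj C" "tensor_objs C Y t \<in> Obj C"
      using t by simp_all
    have [simp]: "s \<in> Arr C" "Dom C s = \<one>" "Cod C s = tensor_objs C Y t"
      "y t \<in> Arr C" "Dom C (y t) = \<one>" "Cod C (y t) = Y t"
      using det y by (simp_all add: deterministic_def)
    have [simp]: "?P t \<in> Arr C" "Dom C (?P t) = tensor_objs C Y t" "Cod C (?P t) = prev_obj C X t"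
      using P[of t] by (simp_all add: predicts_def)
    \<comment> \<open>Here \<open>k \<le> t\<close> matters: \<open>BF t\<close> is then the chosen
      conditional rather than a prescribed filter.\<close>
    have cond: "is_conditional C (tensor_objs C Y t) (X t) (Y t)
        ((\<iota> (X t) \<boxtimes> g t) \<cdot> copy (X t) \<cdot> f t \<cdot> ?P t) (BF t)"
      unfolding BF_def using P t by (intro filter_seq_conditional assms(2)) simp_all
    then have [simp]: "BF t \<in> Arr C" "Dom C (BF t) = tensor_objs C Y t \<otimes> Y t" "Cod C (BF t) = X t"
      by (simp_all only: is_conditional_def hom_iff)
    have s_map: "tensor_states C ((!) (map y [0..<t])) t = s"
      unfolding s_def by (rule tensor_states_cong) simp
    \<comment> \<open>At \<open>t = 0\<close> both factors are the identity of the unit, in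
      agreement with \<open>prev_IBF\<close>.\<close>
    have prev: "prev_IBF C BF y t = ?P t \<cdot> s"
      by (cases t) (simp_all add: prev_IBF_def IBF_def BF_def s_def del: filter_seq.simps(2))
    have "is_state_conditional C (X t) (Y t)
        ((\<iota> (X t) \<boxtimes> g t) \<cdot> copy (X t) \<cdot> f t \<cdot> prev_IBF C BF y t) (cnd t (map y [0..<t]))"
      using state_conditional_instantiate[OF cond det] by (simp add: prev cnd_def s_map)
    \<comment> \<open>Naturality carries the inverse unitor past \<open>y t\<close>, which gives
      \<open>tensor_states\<close> one step later.\<close>
    moreover have "IBF C BF y t = cnd t (map y [0..<t]) \<cdot> y t"
      by (simp add: IBF_def cnd_def s_map Lunit_inv_nat s_def[symmetric])
    ultimately show ?thesis
      by blast
  qed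
  then show "\<exists>BF cnd. (\<forall>t<k. BF t = BF0 t) \<and>
      (\<forall>t\<le>n. is_bayes_filter C X Y n p t (BF t)) \<and>
      (\<forall>y. (\<forall>t\<le>n. deterministic C \<one> (Y t) (y t)) \<longrightarrow>
        (\<forall>t. k \<le> t \<and> t \<le> n \<longrightarrow>
          is_state_conditional C (X t) (Y t)
            ((\<iota> (X t) \<boxtimes> g t) \<cdot> copy (X t) \<cdot> f t \<cdot> prev_IBF C BF y t)
            (cnd t (map y [0..<t])) \<and>
          IBF C BF y t = cnd t (map y [0..<t]) \<cdot> y t))"
    using P by (intro exI[of _ BF] exI[of _ cnd]) (simp add: BF_def)
qed

end
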